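(* Let $\mathfrak{g}=\mathfrak{sl}(3,\mathbb{C})$ and let $\phi:\mathfrak{g}\to\mathfrak{gl}(V(\lambda))$ be the irreducible finite-dimensional representation with highest weight $\lambda$. Let $\mu_1,\dots,\mu_s$ be the distinct dominant weights in the set $\Pi(\lambda)$ of weights of $V(\lambda)$, and let $k_i=|O_{\mu_i}|$ be the size of the $\mathscr{W}(\mathrm{A}_2)$-orbit of $\mu_i$. Then $$f_\phi(z_0,L)=\prod_{i=1}^s (f_{\mu_i})^{m_\lambda(\mu_i)},$$ where each orbital factor $f_{\mu_i}$ is an irreducible polynomial of degree $k_i$.
   Context: For a finite-dimensional representation $\phi$ of $\mathfrak{g}$, the characteristic polynomial is $f_\phi(z_0,L)=\det(z_0I+\phi(L))$, regarded as a polynomial in $z_0$ and the coordinates of $L\in\mathfrak{g}$ with respect to a Chevalley basis (e.g. $H_1=E_{11}-E_{22}$, $H_2=E_{22}-E_{33}$, $E_{ij}$ for $i\neq j$), equivalently a polynomial function on $\mathbb{C}\times\mathfrak{g}$. $\mathfrak{h}$ is the diagonal Cartan subalgebra, $\mathscr{W}(\mathrm{A}_2)\cong\mathfrak{S}_3$ the Weyl group acting on $\mathfrak{h}^*$, and $O_\mu=\mathscr{W}\mu$. $m_\lambda(\mu)$ is the multiplicity (dimension of the weight space) of $\mu$ in $V(\lambda)$. Orbital factor: for a dominant integral weight $\mu$ and a diagonalizable $L\in\mathfrak{g}$ with eigenvalues $\theta_1,\theta_2,\theta_3$, put $h=\mathrm{diag}(\theta_1,\theta_2,\theta_3)\in\mathfrak{h}$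 and $f_\mu(z_0,L)=\prod_{\nu\in O_\mu}(z_0+\nu(h))$; this is independent of the ordering of the eigenvalues and extends uniquely to a polynomial function on $\mathbb{C}\times\mathfrak{g}$, still denoted $f_\mu$. Irreducibility is in the polynomial ring in $z_0$ and the coordinates of $L$ over $\mathbb{C}$. *)

theory Defs
  imports "HOL-Analysis.Analysis" "HOL-Library.Poly_Mapping" "HOL-Computational_Algebra.Factorial_Ring"
begin

text \<open>A polynomial in the variables X_0, X_1, ... is a finitely supported map from
  monomials (finitely supported exponent vectors) to coefficients.  Variable 0 is z_0,
  variables 1..8 are the coordinates of L with respect to the Chevalley basis
  H1, H2, E12, E13, E21, E23, E31, E32 (in this order).\<close>

type_synonym mpoly = "(nat \<Rightarrow>\<^sub>0 nat) \<Rightarrow>\<^sub>0 complex"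

definition mpoly_eval :: "mpoly \<Rightarrow> (nat \<Rightarrow> complex) \<Rightarrow> complex" where
  "mpoly_eval p c = (\<Sum>m\<in>Poly_Mapping.keys p. Poly_Mapping.lookup p m * (\<Prod>i\<in>Poly_Mapping.keys m. c i ^ Poly_Mapping.lookup m i))"

definition total_degree :: "mpoly \<Rightarrow> nat" where
  "total_degree p = Max (insert 0 ((\<lambda>m. \<Sum>i\<in>Poly_Mapping.keys m. Poly_Mapping.lookup m i) ` Poly_Mapping.keys p))"

definition sl3 :: "(complex^3^3) set" where
  "sl3 = {X. trace X = 0}"

text \<open>The element L = c1 H1 + c2 H2 + c3 E12 + c4 E13 + c5 E21 + c6 E23 + c7 E31 + c8 E32
  (indices of the 3x3 matrix are 1,2,3 in the numeral type 3).\<close>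
definition sl3_elem :: "(nat \<Rightarrow> complex) \<Rightarrow> complex^3^3" where
  "sl3_elem c = (\<chi> i j.
     if i = 1 \<and> j = 1 then c 1
     else if i = 2 \<and> j = 2 then - c 1 + c 2
     else if i = 3 \<and> j = 3 then - c 2
     else if i = 1 \<and> j = 2 then c 3
     else if i = 1 \<and> j = 3 then c 4
     else if i = 2 \<and> j = 1 then c 5
     else if i = 2 \<and> j = 3 then c 6
     else if i = 3 \<and> j = 1 then c 7
     else if i = 3 \<and> j = 2 then c 8
     else 0)"

definition basis_elem :: "nat \<Rightarrow> complex^3^3" where
  "basis_elem k = sl3_elem (\<lambda>l. if l = k then 1 else 0)"

abbreviation "H1 \<equiv> basis_elem 1"
abbreviation "H2 \<equiv> basis_elem 2"
abbreviation "E12 \<equiv> basis_elem 3"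
abbreviation "E23 \<equiv> basis_elem 6"

definition mscale :: "complex \<Rightarrow> complex^'m^'n \<Rightarrow> complex^'m^'n" where
  "mscale a X = (\<chi> i j. a * X $ i $ j)"

definition is_rep :: "(complex^3^3 \<Rightarrow> complex^'n^'n) \<Rightarrow> bool" where
  "is_rep \<phi> \<longleftrightarrow>
     (\<forall>X\<in>sl3. \<forall>Y\<in>sl3. \<phi> (X + Y) = \<phi> X + \<phi> Y) \<and>
     (\<forall>a. \<forall>X\<in>sl3. \<phi> (mscale a X) = mscale a (\<phi> X)) \<and>
     (\<forall>X\<in>sl3. \<forall>Y\<in>sl3. \<phi> (X ** Y - Y ** X) = \<phi> X ** \<phi> Y - \<phi> Y ** \<phi> X)"

definition is_irreducible_rep :: "(complex^3^3 \<Rightarrow> complex^'n^'n) \<Rightarrow> bool" where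
  "is_irreducible_rep \<phi> \<longleftrightarrow> is_rep \<phi> \<and>
     (\<forall>W. vec.subspace W \<and> (\<forall>X\<in>sl3. \<forall>w\<in>W. \<phi> X *v w \<in> W) \<longrightarrow> W = {0} \<or> W = UNIV)"

text \<open>Weights are linear functionals on the Cartan subalgebra h, represented by the pair
  (mu(H1), mu(H2)).\<close>
type_synonym weight = "complex \<times> complex"

definition weight_space :: "(complex^3^3 \<Rightarrow> complex^'n^'n) \<Rightarrow> weight \<Rightarrow> (complex^'n) set" where
  "weight_space \<phi> \<mu> = {v. \<phi> H1 *v v = fst \<mu> *s v \<and> \<phi> H2 *v v = snd \<mu> *s v}"

definition has_highest_weight :: "(complex^3^3 \<Rightarrow> complex^'n^'n) \<Rightarrow> weight \<Rightarrow> bool" where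
  "has_highest_weight \<phi> hw \<longleftrightarrow>
     (\<exists>v. v \<noteq> 0 \<and> v \<in> weight_space \<phi> hw \<and> \<phi> E12 *v v = 0 \<and> \<phi> E23 *v v = 0)"

definition weights :: "(complex^3^3 \<Rightarrow> complex^'n^'n) \<Rightarrow> weight set" where
  "weights \<phi> = {\<mu>. weight_space \<phi> \<mu> \<noteq> {0}}"

definition weight_mult :: "(complex^3^3 \<Rightarrow> complex^'n^'n) \<Rightarrow> weight \<Rightarrow> nat" where
  "weight_mult \<phi> \<mu> = vec.dim (weight_space \<phi> \<mu>)"

definition dominant :: "weight \<Rightarrow> bool" where
  "dominant \<mu> \<longleftrightarrow> fst \<mu> \<in> \<nat> \<and> snd \<mu> \<in> \<nat>"

text \<open>Value of the weight mu at h = diag(theta1,theta2,theta3) in h (trace zero):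
  h = theta1 H1 + (theta1+theta2) H2.\<close>
definition wt_at :: "weight \<Rightarrow> complex^3 \<Rightarrow> complex" where
  "wt_at \<mu> \<theta> = fst \<mu> * \<theta> $ 1 + snd \<mu> * (\<theta> $ 1 + \<theta> $ 2)"

definition H1vec :: "complex^3" where
  "H1vec = (\<chi> i. if i = 1 then 1 else if i = 2 then -1 else 0)"
definition H2vec :: "complex^3" where
  "H2vec = (\<chi> i. if i = 2 then 1 else if i = 3 then -1 else 0)"

text \<open>The Weyl group S_3 acts on h by permuting diagonal entries; on h* by
  (w mu)(h) = mu(w^-1 h).\<close>
definition weyl_act :: "(3 \<Rightarrow> 3) \<Rightarrow> weight \<Rightarrow> weight" where
  "weyl_act \<sigma> \<mu> = (wt_at \<mu> (\<chi> i. H1vec $ \<sigma> i), wt_at \<mu> (\<chi> i. H2vec $ \<sigma> i))"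

definition orbit :: "weight \<Rightarrow> weight set" where
  "orbit \<mu> = {weyl_act \<sigma> \<mu> | \<sigma>. \<sigma> permutes (UNIV :: 3 set)}"

definition diag_mat :: "complex^3 \<Rightarrow> complex^3^3" where
  "diag_mat \<theta> = (\<chi> i j. if i = j then \<theta> $ i else 0)"

definition char_poly :: "(complex^3^3 \<Rightarrow> complex^'n^'n) \<Rightarrow> mpoly" where
  "char_poly \<phi> = (THE p. \<forall>c. mpoly_eval p c = det (mat (c 0) + \<phi> (sl3_elem c)))"

definition orbital_factor :: "weight \<Rightarrow> mpoly" where
  "orbital_factor \<mu> = (THE p. \<forall>c P \<theta>. invertible P \<and> sl3_elem c = P ** diag_mat \<theta> ** matrix_inv P
      \<longrightarrow> mpoly_eval p c = (\<Prod>\<nu>\<in>orbit \<mu>. c 0 + wt_at \<nu> \<theta>))"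

end

theory Submission
  imports Defs "HOL-Computational_Algebra.Primes"
    "HOL-Computational_Algebra.Fundamental_Theorem_Algebra"
begin

text \<open>Polynomials agreeing on the diagonalizable matrices are equal, so the factorisation only has to
  be checked at \<open>L = P D P\<^sup>-\<^sup>1\<close> with \<open>D\<close> diagonal. The determinant of \<open>z\<^sub>0 + \<phi>(P D P\<^sup>-\<^sup>1)\<close> does not
  depend on \<open>P\<close>: along a path of \<open>P\<close>'s the matrix \<open>\<phi>(P D P\<^sup>-\<^sup>1)\<close> moves with velocity a commutator
  \<open>[A, \<phi>(P D P\<^sup>-\<^sup>1)]\<close>, in which direction the determinant is stationary. At \<open>P = 1\<close> a basis of weight
  vectors gives the product over all weights, and taking permutation matrices for \<open>P\<close> shows that
  multiplicities are constant on Weyl orbits.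

  For irreducibility, restrict a factor \<open>g\<close> of an orbital factor to the companion matrices, whose
  entries are symmetric in the eigenvalues. There \<open>g\<close> is a product over a subset of the orbit, the
  same subset along the segment joining the eigenvalue vector to any of its permutations; so the
  subset is stable under the Weyl group, hence empty or the whole orbit.\<close>

section \<open>Polynomials as functions\<close>

text \<open>The main obstacle is conjugation: \<open>\<phi>\<close> represents only the Lie algebra,
  so no operator on the module is at hand that turns conjugation of L by P into conjugation of
  \<open>\<phi> L\<close>. Differentiating replaces such an operator by brackets, which
  \<open>\<phi>\<close> preserves. The path has a complex parameter because deleting the finitely
  many singular matrices on it then leaves a connected set. The basis of weight vectors is itself a
  consequence of irreducibility, the highest weight vector being the first weight vector available.
  Both polynomials in the statement are \<open>THE\<close> terms, so their existence has to come
  from explicit determinants. For irreducibility, a factor that is constant in z_0 over one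
  companion matrix is not yet a constant; the gap is closed on lines through that matrix, where the
  orbital factor is monic in z_0 and its factors therefore keep their z_0-degree.\<close>

definition monom_eval :: "(nat \<Rightarrow>\<^sub>0 nat) \<Rightarrow> (nat \<Rightarrow> 'a) \<Rightarrow> 'a::comm_semiring_1" where
  "monom_eval m c = (\<Prod>i\<in>Poly_Mapping.keys m. c i ^ Poly_Mapping.lookup m i)"

lemma monom_eval_superset:
  assumes "finite A" "Poly_Mapping.keys m \<subseteq> A"
  shows "monom_eval m c = (\<Prod>i\<in>A. c i ^ Poly_Mapping.lookup m i)"
  unfolding monom_eval_def using assms
  by (intro prod.mono_neutral_left) (auto simp: in_keys_iff)

lemma monom_eval_add: "monom_eval (m + n) c = monom_eval m c * monom_eval n c"
proof -
  let ?A = "Poly_Mapping.keys m \<union> Poly_Mapping.keys n"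
  have "monom_eval (m + n) c = (\<Prod>i\<in>?A. c i ^ Poly_Mapping.lookup (m + n) i)"
    by (rule monom_eval_superset) (auto simp: Poly_Mapping.keys_add)
  also have "\<dots> = (\<Prod>i\<in>?A. c i ^ Poly_Mapping.lookup m i) * (\<Prod>i\<in>?A. c i ^ Poly_Mapping.lookup n i)"
    by (simp add: lookup_add power_add prod.distrib)
  also have "\<dots> = monom_eval m c * monom_eval n c"
    by (subst (1 2) monom_eval_superset[of ?A]) auto
  finally show ?thesis .
qed

lemma monom_eval_0 [simp]: "monom_eval 0 c = 1"
  by (simp add: monom_eval_def)

lemma mpoly_eval_superset:
  assumes "finite A" "Poly_Mapping.keys p \<subseteq> A"
  shows "mpoly_eval p c = (\<Sum>m\<in>A. Poly_Mapping.lookup p m * monom_eval m c)"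
  unfolding mpoly_eval_def monom_eval_def[symmetric] using assms
  by (intro sum.mono_neutral_left) (auto simp: in_keys_iff)

lemma mpoly_eval_add: "mpoly_eval (p + q) c = mpoly_eval p c + mpoly_eval q c"
proof -
  let ?A = "Poly_Mapping.keys p \<union> Poly_Mapping.keys q"
  have "mpoly_eval (p + q) c = (\<Sum>m\<in>?A. Poly_Mapping.lookup (p + q) m * monom_eval m c)"
    by (rule mpoly_eval_superset) (auto simp: Poly_Mapping.keys_add)
  also have "\<dots> = (\<Sum>m\<in>?A. Poly_Mapping.lookup p m * monom_eval m c)
      + (\<Sum>m\<in>?A. Poly_Mapping.lookup q m * monom_eval m c)"
    by (simp add: lookup_add ring_distribs sum.distrib)
  also have "\<dots> = mpoly_eval p c + mpoly_eval q c"
    by (subst (1 2) mpoly_eval_superset[of ?A]) auto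
  finally show ?thesis .
qed

lemma mpoly_eval_single: "mpoly_eval (Poly_Mapping.single m a) c = a * monom_eval m c"
  by (subst mpoly_eval_superset[of "{m}"]) auto

lemma mpoly_eval_0 [simp]: "mpoly_eval 0 c = 0"
  by (simp add: mpoly_eval_def)

lemma mpoly_eval_1 [simp]: "mpoly_eval 1 c = 1"
  using mpoly_eval_single[of 0 1 c] by simp

lemma mpoly_eval_sum: "mpoly_eval (\<Sum>x\<in>A. f x) c = (\<Sum>x\<in>A. mpoly_eval (f x) c)"
  by (induction A rule: infinite_finite_induct) (auto simp: mpoly_eval_add)

lemma mpoly_sum_monomials:
  fixes p :: mpoly
  shows "p = (\<Sum>m\<in>Poly_Mapping.keys p. Poly_Mapping.single m (Poly_Mapping.lookup p m))"
proof (rule poly_mapping_eqI)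
  fix k
  have "Poly_Mapping.lookup (\<Sum>m\<in>Poly_Mapping.keys p. Poly_Mapping.single m (Poly_Mapping.lookup p m)) k
     = (\<Sum>m\<in>Poly_Mapping.keys p. if m = k then Poly_Mapping.lookup p m else 0)"
    by (simp add: lookup_sum lookup_single when_def)
  also have "\<dots> = Poly_Mapping.lookup p k"
    by (simp add: in_keys_iff)
  finally show "Poly_Mapping.lookup p k =
    Poly_Mapping.lookup (\<Sum>m\<in>Poly_Mapping.keys p. Poly_Mapping.single m (Poly_Mapping.lookup p m)) k"
    by simp
qed

lemma mpoly_eval_mult: "mpoly_eval (p * q) c = mpoly_eval p c * mpoly_eval q c"
proof -
  let ?s = "\<lambda>p m. Poly_Mapping.single m (Poly_Mapping.lookup p m)"
  have "p * q = (\<Sum>m\<in>Poly_Mapping.keys p. ?s p m) * (\<Sum>n\<in>Poly_Mapping.keys q. ?s q n)"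
    using mpoly_sum_monomials[of p] mpoly_sum_monomials[of q] by simp
  also have "\<dots> = (\<Sum>m\<in>Poly_Mapping.keys p. \<Sum>n\<in>Poly_Mapping.keys q.
      Poly_Mapping.single (m + n) (Poly_Mapping.lookup p m * Poly_Mapping.lookup q n))"
    by (simp add: sum_product mult_single)
  finally have "mpoly_eval (p * q) c = (\<Sum>m\<in>Poly_Mapping.keys p. \<Sum>n\<in>Poly_Mapping.keys q.
      (Poly_Mapping.lookup p m * monom_eval m c) * (Poly_Mapping.lookup q n * monom_eval n c))"
    by (simp add: mpoly_eval_sum mpoly_eval_single monom_eval_add algebra_simps)
  also have "\<dots> = mpoly_eval p c * mpoly_eval q c"
    by (simp add: mpoly_eval_def monom_eval_def sum_product)
  finally show ?thesis .
qed

lemma mpoly_eval_uminus: "mpoly_eval (- p) c = - mpoly_eval p c"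
  using mpoly_eval_add[of p "- p" c] by (simp add: eq_neg_iff_add_eq_0 add.commute)

lemma mpoly_eval_diff: "mpoly_eval (p - q) c = mpoly_eval p c - mpoly_eval q c"
  using mpoly_eval_add[of p "- q" c] by (simp add: mpoly_eval_uminus)

lemma mpoly_eval_prod: "mpoly_eval (\<Prod>x\<in>A. f x) c = (\<Prod>x\<in>A. mpoly_eval (f x) c)"
  by (induction A rule: infinite_finite_induct) (auto simp: mpoly_eval_mult)

lemma mpoly_eval_power: "mpoly_eval (p ^ n) c = mpoly_eval p c ^ n"
  by (induction n) (auto simp: mpoly_eval_mult)

text \<open>A Vandermonde argument: the functional given by the a m kills all powers, hence all
  polynomials, and a polynomial vanishing at every node but one isolates a single
  coefficient.\<close>

lemma power_sums_zero_imp_coeffs_zero: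
  fixes a x :: "'b \<Rightarrow> 'a::field"
  assumes "finite A" "inj_on x A" "\<And>s::nat. (\<Sum>m\<in>A. a m * x m ^ s) = 0" "m \<in> A"
  shows "a m = 0"
proof -
  have *: "(\<Sum>m\<in>A. a m * poly Q (x m)) = 0" for Q
  proof -
    have "(\<Sum>m\<in>A. a m * poly Q (x m)) = (\<Sum>i\<le>degree Q. coeff Q i * (\<Sum>m\<in>A. a m * x m ^ i))"
      by (simp add: poly_altdef sum_distrib_left sum.swap[of _ _ A] mult_ac)
    then show ?thesis by (simp add: assms)
  qed
  define Q where "Q = (\<Prod>n\<in>A - {m}. [:- x n, 1:])"
  have "(\<Sum>n\<in>A. a n * poly Q (x n)) = a m * poly Q (x m) + (\<Sum>n\<in>A - {m}. a n * poly Q (x n))"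
    using assms by (simp add: sum.remove)
  also have "(\<Sum>n\<in>A - {m}. a n * poly Q (x n)) = 0"
    using \<open>finite A\<close> by (intro sum.neutral) (auto simp: Q_def poly_prod)
  finally have "a m * poly Q (x m) = 0" using * by simp
  moreover have "poly Q (x m) \<noteq> 0"
    using assms by (auto simp: Q_def poly_prod inj_on_def)
  ultimately show ?thesis by simp
qed

text \<open>Evaluating at the \<open>s\<close>-th powers of distinct primes turns the monomials into powers of
  distinct integers, by unique factorisation.\<close>

lemma mpoly_eq_0_if_eval_0:
  assumes "\<And>c. mpoly_eval p c = 0"
  shows "p = 0"
proof -
  have "infinite {q::nat. prime q}" by (rule primes_infinite)
  then obtain pr :: "nat \<Rightarrow> nat" where pr: "inj pr" "range pr \<subseteq> {q. prime q}"
    using infinite_countable_subset by blast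
  have inj: "inj_on (\<lambda>m. of_nat (monom_eval m pr) :: complex) (Poly_Mapping.keys p)"
  proof (rule inj_onI)
    fix m n assume eq: "(of_nat (monom_eval m pr) :: complex) = of_nat (monom_eval n pr)"
    have mult: "multiplicity (pr i) (monom_eval k pr) = Poly_Mapping.lookup k i" for k i
    proof -
      have "monom_eval k pr = (\<Prod>q\<in>pr ` Poly_Mapping.keys k. q ^ Poly_Mapping.lookup k (inv pr q))"
        using pr(1) unfolding monom_eval_def
        by (subst prod.reindex) (auto intro: inj_on_subset)
      then have "multiplicity (pr i) (monom_eval k pr) =
        (if pr i \<in> pr ` Poly_Mapping.keys k then Poly_Mapping.lookup k (inv pr (pr i)) else 0)"
        using pr(2) by (subst multiplicity_prod_prime_powers[symmetric]) auto
      then show ?thesis using pr(1) by (auto simp: inj_image_mem_iff in_keys_iff)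
    qed
    have "monom_eval m pr = monom_eval n pr" using eq by simp
    then show "m = n" using mult by (intro poly_mapping_eqI) metis
  qed
  have "(\<Sum>m\<in>Poly_Mapping.keys p. Poly_Mapping.lookup p m * of_nat (monom_eval m pr) ^ s) = 0" for s
  proof -
    have "monom_eval m (\<lambda>i. of_nat (pr i) ^ s) = (of_nat (monom_eval m pr) ^ s :: complex)" for m
      by (simp add: monom_eval_def prod_power_distrib power_mult[symmetric] mult.commute)
    then show ?thesis
      using assms[of "\<lambda>i. of_nat (pr i) ^ s"] by (simp add: mpoly_eval_def monom_eval_def)
  qed
  from power_sums_zero_imp_coeffs_zero[OF _ inj this]
  have "Poly_Mapping.lookup p m = 0" for m by (cases "m \<in> Poly_Mapping.keys p") (auto simp: in_keys_iff)
  then show ?thesis by (intro poly_mapping_eqI) simp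
qed

lemma mpoly_eqI:
  assumes "\<And>c. mpoly_eval p c = mpoly_eval q c"
  shows "p = q"
  using mpoly_eq_0_if_eval_0[of "p - q"] assms by (simp add: mpoly_eval_diff)

section \<open>Polynomial functions and their restriction to curves\<close>

definition polyfun :: "((nat \<Rightarrow> complex) \<Rightarrow> complex) \<Rightarrow> bool" where
  "polyfun F \<longleftrightarrow> (\<exists>p. \<forall>c. mpoly_eval p c = F c)"

lemma polyfun_const [intro]: "polyfun (\<lambda>c. a)"
  unfolding polyfun_def using mpoly_eval_single[of 0 a] by (intro exI[of _ "Poly_Mapping.single 0 a"]) simp

lemma polyfun_var [intro]: "polyfun (\<lambda>c. c i)"
  unfolding polyfun_def
  by (rule exI[of _ "Poly_Mapping.single (Poly_Mapping.single i 1) 1"])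
     (simp add: mpoly_eval_single monom_eval_def)

lemma polyfun_mpoly_eval [intro]: "polyfun (mpoly_eval p)"
  unfolding polyfun_def by blast

lemma polyfun_add [intro]: "polyfun F \<Longrightarrow> polyfun G \<Longrightarrow> polyfun (\<lambda>c. F c + G c)"
  unfolding polyfun_def by (metis mpoly_eval_add)

lemma polyfun_mult [intro]: "polyfun F \<Longrightarrow> polyfun G \<Longrightarrow> polyfun (\<lambda>c. F c * G c)"
  unfolding polyfun_def by (metis mpoly_eval_mult)

lemma polyfun_uminus [intro]: "polyfun F \<Longrightarrow> polyfun (\<lambda>c. - F c)"
  unfolding polyfun_def by (metis mpoly_eval_uminus)

lemma polyfun_diff [intro]: "polyfun F \<Longrightarrow> polyfun G \<Longrightarrow> polyfun (\<lambda>c. F c - G c)"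
  unfolding polyfun_def by (metis mpoly_eval_diff)

lemma polyfun_power [intro]: "polyfun F \<Longrightarrow> polyfun (\<lambda>c. F c ^ n)"
  unfolding polyfun_def by (metis mpoly_eval_power)

lemma polyfun_sum [intro]: "(\<And>x. x \<in> A \<Longrightarrow> polyfun (F x)) \<Longrightarrow> polyfun (\<lambda>c. \<Sum>x\<in>A. F x c)"
  by (induction A rule: infinite_finite_induct) auto

lemma polyfun_prod [intro]: "(\<And>x. x \<in> A \<Longrightarrow> polyfun (F x)) \<Longrightarrow> polyfun (\<lambda>c. \<Prod>x\<in>A. F x c)"
  by (induction A rule: infinite_finite_induct) auto

lemma polyfun_det:
  assumes "\<And>i j. polyfun (\<lambda>c. M c $ i $ j)"
  shows "polyfun (\<lambda>c. det (M c :: complex^'n^'n))"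
  unfolding det_def using assms by (intro polyfun_sum polyfun_mult polyfun_const polyfun_prod)

text \<open>The outer variable is z_0, the inner one the parameter t of a curve of matrices.
  Factorisations in z_0 then take place over the domain C[t] and hold for all t at once.\<close>

definition poly2 :: "complex poly poly \<Rightarrow> complex \<Rightarrow> complex \<Rightarrow> complex" where
  "poly2 G z t = poly (poly G [:z:]) t"

lemma poly2_simps:
  "poly2 (F + G) z t = poly2 F z t + poly2 G z t"
  "poly2 (F * G) z t = poly2 F z t * poly2 G z t"
  "poly2 (F - G) z t = poly2 F z t - poly2 G z t"
  "poly2 [:[:a:]:] z t = a"
  "poly2 [:q:] z t = poly q t"
  "poly2 [:q, 1:] z t = poly q t + z"
  "poly2 (smult q F) z t = poly q t * poly2 F z t"
  "poly2 1 z t = 1" "poly2 0 z t = 0"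
  by (auto simp: poly2_def)

lemma poly2_power: "poly2 (F ^ n) z t = poly2 F z t ^ n"
  by (induction n) (auto simp: poly2_simps)

lemma poly2_sum: "poly2 (\<Sum>x\<in>A. f x) z t = (\<Sum>x\<in>A. poly2 (f x) z t)"
  by (induction A rule: infinite_finite_induct) (auto simp: poly2_simps)

lemma poly2_prod: "poly2 (\<Prod>x\<in>A. f x) z t = (\<Prod>x\<in>A. poly2 (f x) z t)"
  by (induction A rule: infinite_finite_induct) (auto simp: poly2_simps)

lemma infinite_cofinite_complex: "finite T \<Longrightarrow> infinite (- T :: complex set)"
  using infinite_UNIV_char_0 finite_compl by blast

lemma poly_eq_0_cofinite:
  fixes p :: "complex poly"
  assumes "finite T" "\<And>t. t \<notin> T \<Longrightarrow> poly p t = 0"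
  shows "p = 0"
proof (rule ccontr)
  assume "p \<noteq> 0"
  then have "finite {t. poly p t = 0}" by (rule poly_roots_finite)
  moreover have "- T \<subseteq> {t. poly p t = 0}" using assms(2) by auto
  ultimately show False using infinite_cofinite_complex[OF assms(1)] finite_subset by blast
qed

text \<open>For fixed z the difference is a polynomial in t with cofinitely many zeros, so every
  constant \<open>[:z:]\<close> is a root of F - G; a nonzero polynomial over C[t] has only finitely
  many roots.\<close>

lemma poly2_eqI:
  assumes "finite T" "\<And>z t. t \<notin> T \<Longrightarrow> poly2 F z t = poly2 G z t"
  shows "F = G"
proof (rule ccontr)
  assume "F \<noteq> G"
  then have fin: "finite {x. poly (F - G) x = 0}" by (intro poly_roots_finite) simp
  have "poly (F - G) [:z:] = 0" for z
    using assms by (intro poly_eq_0_cofinite[of T]) (auto simp: poly2_def)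
  then have "range (\<lambda>z::complex. [:z:]) \<subseteq> {x. poly (F - G) x = 0}" by auto
  moreover have "infinite (range (\<lambda>z::complex. [:z:]))"
    by (simp add: finite_image_iff inj_on_def infinite_UNIV_char_0)
  ultimately show False using fin finite_subset by blast
qed

lemma mpoly_eval_poly2:
  "\<exists>G. \<forall>z t. mpoly_eval p (\<lambda>i. poly2 (X i) z t) = poly2 G z t"
proof
  let ?G = "\<Sum>m\<in>Poly_Mapping.keys p. [:[:Poly_Mapping.lookup p m:]:] * monom_eval m X"
  show "\<forall>z t. mpoly_eval p (\<lambda>i. poly2 (X i) z t) = poly2 ?G z t"
    by (simp add: mpoly_eval_def poly2_sum poly2_simps monom_eval_def poly2_prod poly2_power)
qed

lemma polyfun_poly2:
  assumes "polyfun F"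
  shows "\<exists>G. \<forall>z t. F (\<lambda>i. poly2 (X i) z t) = poly2 G z t"
  using assms mpoly_eval_poly2 unfolding polyfun_def by metis

lemma polyfun_poly:
  assumes "polyfun F"
  shows "\<exists>q. \<forall>t. F (\<lambda>i. poly (X i) t) = poly q t"
proof -
  obtain G where "\<forall>z t. F (\<lambda>i. poly2 [:X i:] z t) = poly2 G z t"
    using polyfun_poly2[OF assms, of "\<lambda>i. [:X i:]"] by blast
  then have "\<forall>t. F (\<lambda>i. poly (X i) t) = poly (poly G [:0:]) t"
    unfolding poly2_simps unfolding poly2_def by blast
  then show ?thesis by blast
qed

section \<open>Diagonalizable traceless matrices\<close>

lemma matrix_inv_left: "invertible P \<Longrightarrow> matrix_inv P ** P = mat 1"
  and matrix_inv_right: "invertible P \<Longrightarrow> P ** matrix_inv P = mat 1"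
  using someI_ex[of "\<lambda>A'. P ** A' = mat 1 \<and> A' ** P = mat 1"]
  unfolding matrix_inv_def invertible_def by auto

text \<open>Applying \<open>A k - l k m\<close> deletes the summand m and rescales the others, which
  leaves a shorter sum. A family of matrices is allowed so that the lemma serves both one matrix
  with distinct eigenvalues and the joint weight vectors of H1 and H2.\<close>

lemma joint_eigenvectors_sum_zero:
  fixes A :: "'k \<Rightarrow> 'a::field^'n^'n" and w :: "'b \<Rightarrow> 'a^'n"
  assumes "finite J"
    and "\<And>i k. i \<in> J \<Longrightarrow> A k *v w i = l k i *s w i"
    and "\<And>i j. i \<in> J \<Longrightarrow> j \<in> J \<Longrightarrow> i \<noteq> j \<Longrightarrow> \<exists>k. l k i \<noteq> l k j"
    and "(\<Sum>i\<in>J. w i) = 0" and "i \<in> J"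
  shows "w i = 0"
  using assms
proof (induction J arbitrary: w i rule: finite_induct)
  case (insert m J)
  have *: "w i = 0" if "i \<in> J" for i
  proof -
    obtain k where k: "l k i \<noteq> l k m" using insert.prems(2)[of i m] \<open>i \<in> J\<close> insert.hyps by auto
    have "(\<Sum>i\<in>insert m J. A k *v w i) = (\<Sum>i\<in>insert m J. l k i *s w i)"
      using insert.prems(1) by (intro sum.cong refl) blast
    then have "A k *v (\<Sum>i\<in>insert m J. w i) - l k m *s (\<Sum>i\<in>insert m J. w i)
      = (\<Sum>i\<in>insert m J. (l k i - l k m) *s w i)"
      by (simp add: vec.linear_sum vec.scale_sum_right vec.scale_left_diff_distrib sum_subtractf
          del: sum.insert)
    then have "(\<Sum>i\<in>J. (l k i - l k m) *s w i) = 0"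
      using insert.hyps insert.prems(3) by (simp del: sum.insert) (simp add: insert.hyps)
    moreover have "A k' *v ((l k j - l k m) *s w j) = l k' j *s ((l k j - l k m) *s w j)" if "j \<in> J" for j k'
      using insert.prems(1)[of j k'] that
      by (simp only: vector_scalar_commute insertI2) (simp only: vector_smult_assoc mult.commute)
    moreover have "\<exists>k. l k i \<noteq> l k j" if "i \<in> J" "j \<in> J" "i \<noteq> j" for i j
      using insert.prems(2)[of i j] that by simp
    ultimately have "(l k i - l k m) *s w i = 0"
      using insert.IH[of "\<lambda>i. (l k i - l k m) *s w i"] \<open>i \<in> J\<close> by blast
    then show ?thesis using k by simp
  qed
  then have "(\<Sum>i\<in>J. w i) = 0" by simp
  then show ?case using insert * by auto
qed simp

lemma distinct_eigenvalues_diagonalize: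
  fixes L :: "complex^3^3"
  assumes "\<And>i. L *v v i = \<theta> $ i *s v i" "\<And>i. v i \<noteq> 0" "inj (\<lambda>i. \<theta> $ i)"
  shows "\<exists>P. invertible P \<and> L = P ** diag_mat \<theta> ** matrix_inv P"
proof -
  define P :: "complex^3^3" where "P = (\<chi> i j. v j $ i)"
  have col: "column j P = v j" for j by (simp add: column_def P_def vec_eq_iff)
  have "c i = 0" if "(\<Sum>i\<in>UNIV. c i *s column i P) = 0" for c i
  proof -
    have "c i *s v i = 0"
      using that assms
      by (intro joint_eigenvectors_sum_zero[where J = UNIV and A = "\<lambda>_::unit. L" and l = "\<lambda>_ i. \<theta> $ i"
            and w = "\<lambda>i. c i *s v i"])
         (auto simp: col vector_scalar_commute vector_smult_assoc mult.commute inj_def)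
    then show ?thesis using assms(2) by simp
  qed
  then have inv: "invertible P"
    unfolding invertible_left_inverse matrix_left_invertible_independent_columns by blast
  have "L ** P = P ** diag_mat \<theta>"
  proof -
    have "(L ** P) $ i $ j = (P ** diag_mat \<theta>) $ i $ j" for i j
    proof -
      have "(L ** P) $ i $ j = (L *v v j) $ i"
        by (simp add: matrix_matrix_mult_def matrix_vector_mult_def P_def)
      also have "\<dots> = (P ** diag_mat \<theta>) $ i $ j"
        by (simp add: assms(1) matrix_matrix_mult_def P_def diag_mat_def if_distrib if_distribR
            sum.delta mult.commute cong: if_cong)
      finally show ?thesis .
    qed
    then show ?thesis by (simp add: vec_eq_iff)
  qed
  then have "L = P ** diag_mat \<theta> ** matrix_inv P"
    by (metis inv matrix_inv_right matrix_mul_assoc matrix_mul_rid)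
  then show ?thesis using inv by blast
qed

lemma depressed_cubic_roots:
  fixes p q :: complex
  shows "\<exists>a b d. a + b + d = 0 \<and> a * b + a * d + b * d = p \<and> a * b * d = q"
proof -
  obtain a where "poly [:- q, p, 0, 1:] a = 0"
    using fundamental_theorem_of_algebra_alt[of "[:- q, p, 0, 1:]"] by auto
  then have a: "a^3 + p * a = q" by (simp add: algebra_simps power3_eq_cube)
  \<comment> \<open>The other two roots have sum -a and product p + a^2, which determines the
    discriminant of their quadratic.\<close>
  define s where "s = csqrt (a^2 - 4 * (p + a^2))"
  have s: "s * s = a^2 - 4 * (p + a^2)" by (simp add: s_def flip: power2_eq_square)
  let ?b = "(- a + s) / 2" and ?d = "(- a - s) / 2"
  have bd: "?b * ?d = p + a^2"
  proof -
    have "?b * ?d = (a^2 - s * s) / 4" by (simp add: field_simps power2_eq_square)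
    then show ?thesis unfolding s by simp
  qed
  have "a + ?b + ?d = 0" by (simp add: field_simps)
  moreover have "a * ?b + a * ?d + ?b * ?d = p"
    unfolding bd by (simp add: field_simps power2_eq_square)
  moreover have "a * ?b * ?d = q"
  proof -
    have "a * ?b * ?d = a * (?b * ?d)" by (simp only: mult.assoc)
    also have "\<dots> = a^3 + p * a" unfolding bd by (simp add: algebra_simps power2_eq_square power3_eq_cube)
    finally show ?thesis using a by simp
  qed
  ultimately show ?thesis by blast
qed

text \<open>Sum of the principal 2x2 minors, that is the second elementary symmetric function of the
  eigenvalues.\<close>

definition e2 :: "complex^3^3 \<Rightarrow> complex" where
  "e2 L = L$1$1 * L$2$2 + L$1$1 * L$3$3 + L$2$2 * L$3$3 - L$1$2 * L$2$1 - L$1$3 * L$3$1 - L$2$3 * L$3$2"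

text \<open>Discriminant of x^3 + e2 x - det, the characteristic polynomial of a traceless L. It is
  polynomial in the entries of L, so on a line it vanishes identically or at finitely many
  points.\<close>

definition disc :: "complex^3^3 \<Rightarrow> complex" where
  "disc L = - 4 * e2 L ^ 3 - 27 * det L ^ 2"

lemma disc_roots:
  fixes a b d :: complex
  assumes "a + b + d = 0"
  shows "- 4 * (a * b + a * d + b * d) ^ 3 - 27 * (a * b * d) ^ 2 = ((a - b) * (a - d) * (b - d))^2"
proof -
  have d: "d = - a - b" using assms by (simp add: algebra_simps eq_neg_iff_add_eq_0)
  show ?thesis unfolding d by (simp add: algebra_simps power2_eq_square power3_eq_cube)
qed

lemma sl3_elem_nth [simp]:
  "sl3_elem c $ 1 $ 1 = c 1" "sl3_elem c $ 2 $ 2 = - c 1 + c 2" "sl3_elem c $ 3 $ 3 = - c 2"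
  "sl3_elem c $ 1 $ 2 = c 3" "sl3_elem c $ 1 $ 3 = c 4" "sl3_elem c $ 2 $ 1 = c 5"
  "sl3_elem c $ 2 $ 3 = c 6" "sl3_elem c $ 3 $ 1 = c 7" "sl3_elem c $ 3 $ 2 = c 8"
  by (simp_all add: sl3_elem_def)

lemma trace_3: "trace (L :: 'a::comm_semiring_1^3^3) = L$1$1 + L$2$2 + L$3$3"
  by (simp add: trace_def sum_3)

lemma sl3_elem_in_sl3 [simp, intro]: "sl3_elem c \<in> sl3"
  by (simp add: sl3_def trace_3)

lemma sl3_diagonalizable:
  assumes "L \<in> sl3" "disc L \<noteq> 0"
  shows "\<exists>P \<theta>. invertible P \<and> L = P ** diag_mat \<theta> ** matrix_inv P"
proof -
  obtain a b d where abd: "a + b + d = 0" "a * b + a * d + b * d = e2 L" "a * b * d = det L"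
    using depressed_cubic_roots by metis
  have "((a - b) * (a - d) * (b - d))^2 \<noteq> 0"
    using disc_roots[OF abd(1)] assms(2) by (simp add: abd disc_def)
  then have dist: "a \<noteq> b" "a \<noteq> d" "b \<noteq> d" by auto
  define \<theta> :: "complex^3" where "\<theta> = vector [a, b, d]"
  have root: "x^3 + e2 L * x - det L = 0" if "x = a \<or> x = b \<or> x = d" for x
  proof -
    have "x^3 + e2 L * x - det L = (x - a) * (x - b) * (x - d) + (a + b + d) * x^2"
      unfolding abd(2,3)[symmetric] by (simp add: algebra_simps power2_eq_square power3_eq_cube)
    then show ?thesis using that abd(1) by auto
  qed
  have ev: "\<exists>v. v \<noteq> 0 \<and> L *v v = \<theta> $ i *s v" for i
  proof -
    have x: "\<theta> $ i = a \<or> \<theta> $ i = b \<or> \<theta> $ i = d"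
      using exhaust_3[of i] by (auto simp: \<theta>_def)
    have tr: "L$3$3 = - L$1$1 - L$2$2"
      using assms(1) by (simp add: sl3_def trace_3 eq_neg_iff_add_eq_0 algebra_simps)
    have "det (L - mat (\<theta> $ i)) = - ((\<theta> $ i)^3 + e2 L * \<theta> $ i - det L)"
      by (simp add: det_3 mat_def e2_def tr algebra_simps power3_eq_cube)
    then have "det (L - mat (\<theta> $ i)) = 0" using root[OF x] by simp
    then have "\<not> invertible (L - mat (\<theta> $ i))" by (simp add: invertible_det_nz)
    then obtain v where "v \<noteq> 0" "(L - mat (\<theta> $ i)) *v v = 0"
      unfolding invertible_left_inverse matrix_left_invertible_ker by blast
    moreover have "mat (\<theta> $ i) *v v = \<theta> $ i *s v"
      by (simp add: mat_def matrix_vector_mult_def vec_eq_iff if_distrib if_distribR sum.delta cong: if_cong)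
    ultimately show ?thesis by (auto simp: matrix_vector_mult_diff_rdistrib)
  qed
  then obtain v where "\<And>i. v i \<noteq> 0" "\<And>i. L *v v i = \<theta> $ i *s v i" by metis
  moreover have "inj (\<lambda>i. \<theta> $ i)"
    using dist by (auto simp: inj_def forall_3 \<theta>_def)
  ultimately show ?thesis using distinct_eigenvalues_diagonalize[of L v \<theta>] by blast
qed

lemma polyfun_sl3_elem: "polyfun (\<lambda>c. sl3_elem c $ i $ j)"
  using exhaust_3[of i] exhaust_3[of j]
  by (auto intro!: polyfun_add polyfun_uminus polyfun_var simp del: add_uminus_conv_diff uminus_add_conv_diff)

lemma polyfun_disc: "polyfun (\<lambda>c. disc (sl3_elem c))"
  unfolding disc_def e2_def det_3
  by (intro polyfun_diff polyfun_add polyfun_mult polyfun_power polyfun_const polyfun_sl3_elem)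

text \<open>The point t = 1 is c', so the discriminant is not identically zero along the
  line.\<close>

lemma finite_disc_zero_on_line:
  assumes "disc (sl3_elem c') \<noteq> 0"
  shows "finite {t. disc (sl3_elem (\<lambda>i. c i + t * (c' i - c i))) = 0}"
proof -
  obtain q where q: "\<And>t. disc (sl3_elem (\<lambda>i. poly [:c i, c' i - c i:] t)) = poly q t"
    using polyfun_poly[OF polyfun_disc, of "\<lambda>i. [:c i, c' i - c i:]"] by blast
  have "poly q 1 \<noteq> 0" using q[of 1] assms by simp
  then have "q \<noteq> 0" by auto
  then have "finite {t. poly q t = 0}" by (rule poly_roots_finite)
  then show ?thesis unfolding q[symmetric] by simp
qed

text \<open>Coordinates of the companion matrix of the cubic with roots \<open>\<theta>\<close>.\<close>

definition companion :: "complex^3 \<Rightarrow> nat \<Rightarrow> complex" where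
  "companion \<theta> k = (if k = 3 \<or> k = 6 then 1
     else if k = 7 then \<theta>$1 * \<theta>$2 * \<theta>$3
     else if k = 8 then - (\<theta>$1 * \<theta>$2 + \<theta>$1 * \<theta>$3 + \<theta>$2 * \<theta>$3) else 0)"

text \<open>The eigenvector for the eigenvalue x is (1, x, x^2). Coordinate 0 may be chosen freely
  because it carries z_0 and does not enter the matrix.\<close>

lemma companion_diagonalizable:
  assumes "\<theta>$1 + \<theta>$2 + \<theta>$3 = 0" "inj (\<lambda>i. \<theta> $ i)"
  shows "\<exists>P. invertible P \<and> sl3_elem ((companion \<theta>)(0 := z)) = P ** diag_mat \<theta> ** matrix_inv P"
proof (rule distinct_eigenvalues_diagonalize[where v = "\<lambda>i. vector [1, \<theta>$i, \<theta>$i * \<theta>$i]"])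
  have th3: "\<theta>$3 = - \<theta>$1 - \<theta>$2"
    using assms(1) by (simp add: eq_neg_iff_add_eq_0 algebra_simps)
  show "sl3_elem ((companion \<theta>)(0 := z)) *v vector [1, \<theta>$i, \<theta>$i * \<theta>$i]
     = \<theta> $ i *s vector [1, \<theta>$i, \<theta>$i * \<theta>$i]" for i :: 3
    using exhaust_3[of i]
    by (auto simp: vec_eq_iff forall_3 matrix_vector_mult_def sum_3 companion_def vector_3 th3 algebra_simps)
  show "vector [1, \<theta>$i, \<theta>$i * \<theta>$i] \<noteq> (0 :: complex^3)" for i :: 3
    by (simp add: vec_eq_iff forall_3)
qed (rule assms(2))

lemma disc_companion:
  assumes "\<theta>$1 + \<theta>$2 + \<theta>$3 = 0" "inj (\<lambda>i. \<theta> $ i)"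
  shows "disc (sl3_elem (companion \<theta>)) \<noteq> 0"
proof -
  have "disc (sl3_elem (companion \<theta>)) = ((\<theta>$1 - \<theta>$2) * (\<theta>$1 - \<theta>$3) * (\<theta>$2 - \<theta>$3))^2"
  proof -
    have "e2 (sl3_elem (companion \<theta>)) = \<theta>$1 * \<theta>$2 + \<theta>$1 * \<theta>$3 + \<theta>$2 * \<theta>$3"
      by (simp add: e2_def companion_def)
    moreover have "det (sl3_elem (companion \<theta>)) = \<theta>$1 * \<theta>$2 * \<theta>$3"
      by (simp add: det_3 companion_def)
    ultimately show ?thesis unfolding disc_def disc_roots[OF assms(1), symmetric] by simp
  qed
  moreover have "\<theta>$1 \<noteq> \<theta>$2" "\<theta>$1 \<noteq> \<theta>$3" "\<theta>$2 \<noteq> \<theta>$3"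
    using injD[OF assms(2), of 1 2] injD[OF assms(2), of 1 3] injD[OF assms(2), of 2 3] by auto
  ultimately show ?thesis by simp
qed

text \<open>Chosen so that real weights are separated by their values at \<open>theta0\<close>.\<close>

definition theta0 :: "complex^3" where "theta0 = vector [1, \<i> - 1, - \<i>]"

lemma theta0: "theta0$1 + theta0$2 + theta0$3 = 0" "inj (\<lambda>i. theta0 $ i)"
  by (auto simp: theta0_def inj_def forall_3 complex_eq_iff)

text \<open>Density in algebraic form: each point c is joined by a line to the companion matrix of
  \<open>theta0\<close>, all but finitely many points of that line are diagonalizable, and c itself
  is the point t = 0.\<close>

lemma mpoly_eqI_diagonalizable:
  assumes "\<And>c P \<theta>. invertible P \<Longrightarrow> sl3_elem c = P ** diag_mat \<theta> ** matrix_inv P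
      \<Longrightarrow> mpoly_eval p c = mpoly_eval q c"
  shows "p = q"
proof (rule mpoly_eqI)
  fix c
  let ?l = "\<lambda>i. [:c i, companion theta0 i - c i:]"
  have pf: "polyfun (\<lambda>c. mpoly_eval p c - mpoly_eval q c)" by blast
  obtain r where r: "\<And>t. mpoly_eval p (\<lambda>i. poly (?l i) t) - mpoly_eval q (\<lambda>i. poly (?l i) t) = poly r t"
    using polyfun_poly[OF pf, of ?l] by blast
  have "r = 0"
  proof (rule poly_eq_0_cofinite)
    show "finite {t. disc (sl3_elem (\<lambda>i. c i + t * (companion theta0 i - c i))) = 0}"
      by (intro finite_disc_zero_on_line disc_companion theta0)
    fix t assume "t \<notin> {t. disc (sl3_elem (\<lambda>i. c i + t * (companion theta0 i - c i))) = 0}"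
    then obtain P \<theta> where "invertible P"
      "sl3_elem (\<lambda>i. c i + t * (companion theta0 i - c i)) = P ** diag_mat \<theta> ** matrix_inv P"
      using sl3_diagonalizable[OF sl3_elem_in_sl3] by blast
    from assms[OF this] show "poly r t = 0" by (simp flip: r)
  qed
  then show "mpoly_eval p c = mpoly_eval q c" using r[of 0] by simp
qed

section \<open>Weyl orbits and orbital factors\<close>

lemma permutes_3_iff:
  fixes \<sigma> :: "3 \<Rightarrow> 3"
  shows "\<sigma> permutes UNIV \<longleftrightarrow> \<sigma> 1 \<noteq> \<sigma> 2 \<and> \<sigma> 1 \<noteq> \<sigma> 3 \<and> \<sigma> 2 \<noteq> \<sigma> 3"
proof -
  have "\<sigma> permutes UNIV \<longleftrightarrow> inj \<sigma>"
  proof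
    assume "inj \<sigma>"
    then have "bij \<sigma>" by (simp add: bij_def finite_UNIV_inj_surj)
    then show "\<sigma> permutes UNIV" by (intro bij_imp_permutes) auto
  qed (rule permutes_inj)
  also have "\<dots> \<longleftrightarrow> \<sigma> 1 \<noteq> \<sigma> 2 \<and> \<sigma> 1 \<noteq> \<sigma> 3 \<and> \<sigma> 2 \<noteq> \<sigma> 3"
    by (auto simp: inj_def forall_3)
  finally show ?thesis .
qed

lemma permutes_3_cases:
  fixes \<sigma> :: "3 \<Rightarrow> 3"
  assumes "\<sigma> permutes UNIV"
  shows "(\<sigma> 1, \<sigma> 2, \<sigma> 3) \<in> {(1,2,3), (1,3,2), (2,1,3), (2,3,1), (3,1,2), (3,2,1)}"
  using exhaust_3[of "\<sigma> 1"] exhaust_3[of "\<sigma> 2"] exhaust_3[of "\<sigma> 3"] assms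
  unfolding permutes_3_iff by (elim disjE; simp)

lemma weyl_act_eq:
  "weyl_act \<sigma> (a, b) = (a * H1vec $ \<sigma> 1 + b * (H1vec $ \<sigma> 1 + H1vec $ \<sigma> 2),
     a * H2vec $ \<sigma> 1 + b * (H2vec $ \<sigma> 1 + H2vec $ \<sigma> 2))"
  by (simp add: weyl_act_def wt_at_def)

lemma Hvec_nth [simp]:
  "H1vec $ 1 = 1" "H1vec $ 2 = -1" "H1vec $ 3 = 0" "H2vec $ 1 = 0" "H2vec $ 2 = 1" "H2vec $ 3 = -1"
  by (simp_all add: H1vec_def H2vec_def)

text \<open>Listing the images as a set lets them coincide, so that the smaller orbits, of size 1
  and 3, are covered as well.\<close>

lemma orbit_eq:
  "orbit (a, b) = {(a, b), (a + b, - b), (- a, a + b), (b, - (a + b)), (- (a + b), a), (- b, - a)}"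
proof
  show "orbit (a, b) \<subseteq> {(a, b), (a + b, - b), (- a, a + b), (b, - (a + b)), (- (a + b), a), (- b, - a)}"
  proof
    fix \<nu> assume "\<nu> \<in> orbit (a, b)"
    then obtain \<sigma> where \<sigma>: "\<nu> = weyl_act \<sigma> (a, b)" "\<sigma> permutes UNIV"
      unfolding orbit_def by blast
    show "\<nu> \<in> {(a, b), (a + b, - b), (- a, a + b), (b, - (a + b)), (- (a + b), a), (- b, - a)}"
      using permutes_3_cases[OF \<sigma>(2)] unfolding \<sigma>(1) weyl_act_eq by auto
  qed
next
  have *: "weyl_act (\<lambda>i. if i = 1 then x else if i = 2 then y else z) (a, b) \<in> orbit (a, b)"
    if "x \<noteq> y" "x \<noteq> z" "y \<noteq> z" for x y z :: 3
    unfolding orbit_def using that by (auto simp: permutes_3_iff)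
  show "{(a, b), (a + b, - b), (- a, a + b), (b, - (a + b)), (- (a + b), a), (- b, - a)} \<subseteq> orbit (a, b)"
    using *[of 1 2 3] *[of 1 3 2] *[of 2 1 3] *[of 2 3 1] *[of 3 1 2] *[of 3 2 1]
    by (simp add: weyl_act_eq)
qed

lemma finite_orbit [simp, intro]: "finite (orbit \<mu>)"
  by (cases \<mu>) (simp add: orbit_eq)

lemma mem_orbit_self [simp, intro]: "\<mu> \<in> orbit \<mu>"
  by (cases \<mu>) (simp add: orbit_eq)

lemma orbit_eqI: "\<nu> \<in> orbit \<mu> \<Longrightarrow> orbit \<nu> = orbit \<mu>"
proof -
  assume "\<nu> \<in> orbit \<mu>"
  moreover obtain a b where \<mu>: "\<mu> = (a, b)" by (cases \<mu>)
  ultimately have "\<nu> = (a, b) \<or> \<nu> = (a + b, - b) \<or> \<nu> = (- a, a + b) \<or> \<nu> = (b, - (a + b))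
    \<or> \<nu> = (- (a + b), a) \<or> \<nu> = (- b, - a)"
    by (simp only: orbit_eq insert_iff empty_iff simp_thms)
  then show "orbit \<nu> = orbit \<mu>"
    unfolding \<mu> by (elim disjE) (simp_all add: orbit_eq insert_commute add.commute)
qed

text \<open>The action is defined through its values on H1 and H2; these span the traceless diagonal
  matrices, on all of which it is therefore the permutation action.\<close>

lemma wt_at_weyl_act:
  assumes "\<sigma> permutes UNIV" "\<theta>$1 + \<theta>$2 + \<theta>$3 = 0"
  shows "wt_at (weyl_act \<sigma> \<mu>) \<theta> = wt_at \<mu> (\<chi> i. \<theta> $ \<sigma> i)"
proof -
  have th3: "\<theta>$3 = - \<theta>$1 - \<theta>$2"
    using assms(2) by (simp add: eq_neg_iff_add_eq_0 algebra_simps)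
  show ?thesis
    using permutes_3_cases[OF assms(1)]
    by (cases \<mu>) (auto simp: weyl_act_eq wt_at_def th3 algebra_simps)
qed

text \<open>Each of the five other points listed in \<open>orbit_eq\<close> has a coordinate that is
  minus a natural number. Dominance makes that coordinate zero, and then the point coincides with
  \<open>\<mu>\<close>.\<close>

lemma dominant_mem_orbit_unique:
  assumes "dominant \<mu>" "dominant \<nu>" "\<nu> \<in> orbit \<mu>"
  shows "\<nu> = \<mu>"
proof -
  obtain m n where \<mu>: "\<mu> = (of_nat m, of_nat n)"
    using assms(1) by (cases \<mu>) (auto simp: dominant_def elim!: Nats_cases)
  obtain k l where \<nu>: "\<nu> = (of_nat k, of_nat l)"
    using assms(2) by (cases \<nu>) (auto simp: dominant_def elim!: Nats_cases)
  have neg: "(of_nat i :: complex) = - of_nat j \<longleftrightarrow> i = 0 \<and> j = 0" for i j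
    by (metis add_eq_0_iff2 add_is_0 neg_equal_0_iff_equal of_nat_0 of_nat_add of_nat_eq_0_iff)
  show ?thesis
    using assms(3) neg[of _ "_ + _"]
    by (auto simp: \<mu> \<nu> orbit_eq neg simp del: of_nat_add simp flip: of_nat_add)
qed

lemma integral_orbit_dominant:
  assumes "fst \<mu> \<in> \<int>" "snd \<mu> \<in> \<int>"
  shows "\<exists>\<nu>\<in>orbit \<mu>. dominant \<nu>"
proof -
  obtain x y where xy: "\<mu> = (of_int x, of_int y)"
    using assms by (cases \<mu>) (auto elim!: Ints_cases)
  have dom: "dominant (of_int i, of_int j)" if "i \<ge> 0" "j \<ge> 0" for i j
    using that of_nat_nat[of i, where 'a = complex] of_nat_nat[of j, where 'a = complex]
    by (metis Nats_1 dominant_def fst_conv of_nat_in_Nats snd_conv)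
  \<comment> \<open>The six closed Weyl chambers cover the plane; in each of them a different orbit
    point is the dominant one.\<close>
  consider "x \<ge> 0" "y \<ge> 0" | "x + y \<ge> 0" "- y \<ge> 0" | "- x \<ge> 0" "x + y \<ge> 0"
    | "y \<ge> 0" "- (x + y) \<ge> 0" | "- (x + y) \<ge> 0" "x \<ge> 0" | "- y \<ge> 0" "- x \<ge> 0"
    by linarith
  then show ?thesis
    using dom[of x y] dom[of "x + y" "- y"] dom[of "- x" "x + y"] dom[of y "- (x + y)"]
      dom[of "- (x + y)" x] dom[of "- y" "- x"]
    unfolding xy orbit_eq by cases simp_all
qed

section \<open>Matrices with polynomial entries, conjugation, and existence of orbital
  factors\<close>

definition polymat :: "((nat \<Rightarrow> complex) \<Rightarrow> complex^'n^'m) \<Rightarrow> bool" where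
  "polymat M \<longleftrightarrow> (\<forall>i j. polyfun (\<lambda>c. M c $ i $ j))"

lemma polymat_intros:
  "polymat M \<Longrightarrow> polymat N \<Longrightarrow> polymat (\<lambda>c. M c + N c)"
  "polyfun f \<Longrightarrow> polymat M \<Longrightarrow> polymat (\<lambda>c. mscale (f c) (M c))"
  "polymat M' \<Longrightarrow> polymat N' \<Longrightarrow> polymat (\<lambda>c. M' c ** N' c)"
  "polyfun f \<Longrightarrow> polymat (\<lambda>c. mat (f c) :: complex^'a^'a)"
proof -
  show "polymat M \<Longrightarrow> polymat N \<Longrightarrow> polymat (\<lambda>c. M c + N c)"
    by (auto simp: polymat_def)
  show "polyfun f \<Longrightarrow> polymat M \<Longrightarrow> polymat (\<lambda>c. mscale (f c) (M c))"
    by (auto simp: polymat_def mscale_def)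
  show "polymat M' \<Longrightarrow> polymat N' \<Longrightarrow> polymat (\<lambda>c. M' c ** N' c)"
    by (auto simp: polymat_def matrix_matrix_mult_def intro!: polyfun_sum polyfun_mult)
  show "polymat (\<lambda>c. mat (f c) :: complex^'a^'a)" if "polyfun f"
  proof -
    have "polyfun (\<lambda>c. (mat (f c) :: complex^'a^'a) $ i $ j)" for i j
      using that by (cases "i = j") (auto simp: mat_def)
    then show ?thesis by (simp add: polymat_def)
  qed
qed

lemma polymat_sl3_elem: "polymat sl3_elem"
  by (simp add: polymat_def polyfun_sl3_elem)

lemma polyfun_det_polymat: "polymat M \<Longrightarrow> polyfun (\<lambda>c. det (M c :: complex^'n^'n))"
  by (simp add: polymat_def polyfun_det)

lemma polyfun_trace_polymat: "polymat M \<Longrightarrow> polyfun (\<lambda>c. trace (M c :: complex^'n^'n))"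
  unfolding polymat_def trace_def by (intro polyfun_sum) blast

lemma mscale_matrix_mult:
  "mscale a X ** Y = mscale a (X ** Y)" "X ** mscale a Y = mscale a (X ** Y)"
  by (simp_all add: mscale_def matrix_matrix_mult_def vec_eq_iff sum_distrib_left mult_ac)

lemma mat_eq_mscale: "mat z = mscale z (mat 1)"
  by (simp add: mat_def mscale_def vec_eq_iff)

context
  fixes P :: "complex^'n^'n"
  assumes P: "invertible P"
begin

lemma conj_add: "P ** (X + Y) ** matrix_inv P = P ** X ** matrix_inv P + P ** Y ** matrix_inv P"
  by (simp add: matrix_add_ldistrib matrix_matrix_mult_def vec_eq_iff ring_distribs sum.distrib)

lemma conj_mscale: "P ** mscale a X ** matrix_inv P = mscale a (P ** X ** matrix_inv P)"
  by (simp add: mscale_matrix_mult)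

lemma conj_mult: "P ** (X ** Y) ** matrix_inv P = (P ** X ** matrix_inv P) ** (P ** Y ** matrix_inv P)"
  by (metis P matrix_inv_left matrix_mul_assoc matrix_mul_rid)

lemma conj_mat: "P ** mat z ** matrix_inv P = mat z"
  by (subst (1 2) mat_eq_mscale) (simp add: mscale_matrix_mult matrix_inv_right[OF P])

lemma det_conj: "det (P ** X ** matrix_inv P) = det X"
proof -
  have "det P * det (matrix_inv P) = 1"
    by (metis P det_I det_mul matrix_inv_right)
  then show ?thesis by (simp add: det_mul mult_ac)
qed

lemma trace_conj: "trace (P ** X ** matrix_inv P) = trace X"
  by (metis P matrix_inv_left matrix_mul_assoc matrix_mul_lid trace_mul_sym)

end

lemma diag_theta_sum:
  assumes "invertible P" "sl3_elem c = P ** diag_mat \<theta> ** matrix_inv P"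
  shows "\<theta>$1 + \<theta>$2 + \<theta>$3 = 0"
proof -
  have "trace (sl3_elem c) = 0" using sl3_elem_in_sl3[of c] unfolding sl3_def by simp
  then have "trace (diag_mat \<theta>) = 0" using assms trace_conj by metis
  then show ?thesis by (simp add: trace_3 diag_mat_def)
qed

lemma diag_mat_nth: "diag_mat \<theta> $ i $ j = (if i = j then \<theta> $ i else 0)"
  by (simp add: diag_mat_def)

lemma det_linear_diag: "det (mat z + mscale a (diag_mat \<theta>)) = (z + a * \<theta>$1) * (z + a * \<theta>$2) * (z + a * \<theta>$3)"
  by (simp add: det_3 mat_def mscale_def diag_mat_nth)

text \<open>For traceless L the number - trace (L^2) / 2 is \<open>e2 L\<close>. Writing it as a
  trace makes the matrix manifestly compatible with conjugation and polynomial in L.\<close>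

definition orbit_matrix :: "complex \<Rightarrow> complex \<Rightarrow> complex \<Rightarrow> complex^3^3 \<Rightarrow> complex^3^3" where
  "orbit_matrix a b z L = (mat z + mscale a L) ** (mat z + mscale a L)
     + mscale b (L ** (mat z + mscale a L)) + mscale (b^2) (L ** L + mat (- (trace (L ** L)) / 2))"

text \<open>For a root \<open>x\<close> of a traceless cubic the other two roots have sum \<open>-x\<close> and product
  \<open>e\<^sub>2 + x\<^sup>2\<close>, so the factors of the orbit starting with \<open>a x\<close> combine to a quadratic in \<open>x\<close>.\<close>

lemma det_orbit_matrix_diag:
  assumes "\<theta>$1 + \<theta>$2 + \<theta>$3 = 0"
  shows "det (orbit_matrix a b z (diag_mat \<theta>)) =
    (z + a * \<theta>$1 - b * \<theta>$2) * (z + a * \<theta>$1 - b * \<theta>$3) * ((z + a * \<theta>$2 - b * \<theta>$1) * (z + a * \<theta>$2 - b * \<theta>$3))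
    * ((z + a * \<theta>$3 - b * \<theta>$1) * (z + a * \<theta>$3 - b * \<theta>$2))"
proof -
  have th3: "\<theta>$3 = - \<theta>$1 - \<theta>$2"
    using assms by (simp add: eq_neg_iff_add_eq_0 algebra_simps)
  define E where "E = - ((\<theta>$1)^2 + (\<theta>$2)^2 + (\<theta>$3)^2) / 2"
  define q where "q x = (z + a * x) * (z + a * x) + b * (x * (z + a * x)) + b^2 * (x * x + E)" for x
  have M: "orbit_matrix a b z (diag_mat \<theta>) = diag_mat (\<chi> i. q (\<theta>$i))"
    by (simp add: orbit_matrix_def vec_eq_iff forall_3 matrix_matrix_mult_def sum_3 mat_def mscale_def
        diag_mat_nth trace_3 q_def E_def power2_eq_square)
  have "det (orbit_matrix a b z (diag_mat \<theta>)) = q (\<theta>$1) * q (\<theta>$2) * q (\<theta>$3)"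
    unfolding M by (simp add: det_3 diag_mat_nth)
  moreover have "q (\<theta>$1) = (z + a * \<theta>$1 - b * \<theta>$2) * (z + a * \<theta>$1 - b * \<theta>$3)"
    "q (\<theta>$2) = (z + a * \<theta>$2 - b * \<theta>$1) * (z + a * \<theta>$2 - b * \<theta>$3)"
    "q (\<theta>$3) = (z + a * \<theta>$3 - b * \<theta>$1) * (z + a * \<theta>$3 - b * \<theta>$2)"
    by (simp_all add: q_def E_def th3 power2_eq_square field_simps)
  ultimately show ?thesis by simp
qed

lemma orbit_matrix_conj:
  assumes "invertible P"
  shows "orbit_matrix a b z (P ** X ** matrix_inv P) = P ** orbit_matrix a b z X ** matrix_inv P"
proof -
  have "trace ((P ** X ** matrix_inv P) ** (P ** X ** matrix_inv P)) = trace (X ** X)"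
    by (simp only: conj_mult[OF assms, symmetric] trace_conj[OF assms])
  then show ?thesis
    by (simp only: orbit_matrix_def conj_add[OF assms] conj_mult[OF assms] conj_mscale[OF assms] conj_mat[OF assms])
qed

text \<open>In terms of eigenvalues the orbit values are a x - b y for the ordered pairs of
  different eigenvalues, the form in which they occur in
  \<open>det_orbit_matrix_diag\<close>.\<close>

lemma wt_at_sum_zero:
  assumes "\<theta>$1 + \<theta>$2 + \<theta>$3 = 0"
  shows "wt_at (a, b) \<theta> = a * \<theta>$1 - b * \<theta>$3" "wt_at (a + b, - b) \<theta> = a * \<theta>$1 - b * \<theta>$2"
    "wt_at (- a, a + b) \<theta> = a * \<theta>$2 - b * \<theta>$3" "wt_at (b, - (a + b)) \<theta> = a * \<theta>$3 - b * \<theta>$2"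
    "wt_at (- (a + b), a) \<theta> = a * \<theta>$2 - b * \<theta>$1" "wt_at (- b, - a) \<theta> = a * \<theta>$3 - b * \<theta>$1"
proof -
  have th3: "\<theta>$3 = - \<theta>$1 - \<theta>$2"
    using assms by (simp add: eq_neg_iff_add_eq_0 algebra_simps)
  show "wt_at (a, b) \<theta> = a * \<theta>$1 - b * \<theta>$3" "wt_at (a + b, - b) \<theta> = a * \<theta>$1 - b * \<theta>$2"
    "wt_at (- a, a + b) \<theta> = a * \<theta>$2 - b * \<theta>$3" "wt_at (b, - (a + b)) \<theta> = a * \<theta>$3 - b * \<theta>$2"
    "wt_at (- (a + b), a) \<theta> = a * \<theta>$2 - b * \<theta>$1" "wt_at (- b, - a) \<theta> = a * \<theta>$3 - b * \<theta>$1"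
    by (simp_all add: wt_at_def th3 algebra_simps)
qed

text \<open>The determinant of the orbit matrix always has six factors, so it is correct exactly for
  weights off the walls. On the walls the orbit has one or three points, and z_0 or det (z_0 + a L)
  takes its place.\<close>

lemma orbital_factor_exists:
  assumes "dominant \<mu>"
  shows "\<exists>p. \<forall>c P \<theta>. invertible P \<and> sl3_elem c = P ** diag_mat \<theta> ** matrix_inv P
      \<longrightarrow> mpoly_eval p c = (\<Prod>\<nu>\<in>orbit \<mu>. c 0 + wt_at \<nu> \<theta>)"
proof -
  obtain m n where \<mu>: "\<mu> = (of_nat m, of_nat n)"
    using assms by (cases \<mu>) (auto simp: dominant_def elim!: Nats_cases)
  have ex: ?thesis if F: "polyfun F"
    and eq: "\<And>c P \<theta>. invertible P \<Longrightarrow> sl3_elem c = P ** diag_mat \<theta> ** matrix_inv P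
      \<Longrightarrow> \<theta>$1 + \<theta>$2 + \<theta>$3 = 0 \<Longrightarrow> F c = (\<Prod>\<nu>\<in>orbit \<mu>. c 0 + wt_at \<nu> \<theta>)" for F
    using F eq diag_theta_sum unfolding polyfun_def by metis
  have linear: "det (mat (c 0) + mscale a (sl3_elem c))
      = (c 0 + a * \<theta>$1) * (c 0 + a * \<theta>$2) * (c 0 + a * \<theta>$3)"
    if "invertible P" "sl3_elem c = P ** diag_mat \<theta> ** matrix_inv P" for c a P \<theta>
  proof -
    have "mat (c 0) + mscale a (sl3_elem c) = P ** (mat (c 0) + mscale a (diag_mat \<theta>)) ** matrix_inv P"
      by (simp only: that(2) conj_add[OF that(1)] conj_mscale[OF that(1)] conj_mat[OF that(1)])
    then show ?thesis by (simp add: det_conj[OF that(1)] det_linear_diag)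
  qed
  have lin_pf: "polyfun (\<lambda>c. det (mat (c 0) + mscale a (sl3_elem c)))" for a
    by (intro polyfun_det_polymat polymat_intros polymat_sl3_elem polyfun_var polyfun_const)
  consider "m = 0" "n = 0" | "m = 0" "n > 0" | "m > 0" "n = 0" | "m > 0" "n > 0" by auto
  then show ?thesis
  proof cases
    case 1
    show ?thesis by (rule ex[of "\<lambda>c. c 0"]) (auto simp: \<mu> 1 orbit_eq wt_at_def)
  next
    case 2
    \<comment> \<open>The orbit of (0, n) takes the values - n x at the eigenvalues x, the negatives
      of those of (n, 0); hence the sign of the scalar.\<close>
    show ?thesis
    proof (rule ex[OF lin_pf[of "- of_nat n"]])
      fix c P \<theta> assume *: "invertible P" "sl3_elem c = P ** diag_mat \<theta> ** matrix_inv P"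
        and sum: "\<theta>$1 + \<theta>$2 + \<theta>$3 = 0"
      have "orbit \<mu> = {(0, of_nat n), (of_nat n, - of_nat n), (- of_nat n, 0)}"
        unfolding \<mu> 2 orbit_eq by auto
      then show "det (mat (c 0) + mscale (- of_nat n) (sl3_elem c)) = (\<Prod>\<nu>\<in>orbit \<mu>. c 0 + wt_at \<nu> \<theta>)"
        using wt_at_sum_zero[OF sum, where a = 0 and b = "of_nat n"] 2
        by (simp add: linear[OF *] mult_ac)
    qed
  next
    case 3
    show ?thesis
    proof (rule ex[OF lin_pf[of "of_nat m"]])
      fix c P \<theta> assume *: "invertible P" "sl3_elem c = P ** diag_mat \<theta> ** matrix_inv P"
        and sum: "\<theta>$1 + \<theta>$2 + \<theta>$3 = 0"
      have "orbit \<mu> = {(of_nat m, 0), (- of_nat m, of_nat m), (0, - of_nat m)}"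
        unfolding \<mu> 3 orbit_eq by auto
      then show "det (mat (c 0) + mscale (of_nat m) (sl3_elem c)) = (\<Prod>\<nu>\<in>orbit \<mu>. c 0 + wt_at \<nu> \<theta>)"
        using wt_at_sum_zero[OF sum, where a = "of_nat m" and b = 0] 3
        by (simp add: linear[OF *] mult_ac)
    qed
  next
    case 4
    define a b :: complex where "a = of_nat m" and "b = of_nat n"
    have pf: "polyfun (\<lambda>c. det (orbit_matrix a b (c 0) (sl3_elem c)))"
      unfolding orbit_matrix_def divide_inverse
      by (intro polyfun_det_polymat polymat_intros polymat_sl3_elem polyfun_var polyfun_const
          polyfun_trace_polymat polyfun_mult polyfun_uminus)
    define os where "os = [(a, b), (a + b, - b), (- a, a + b), (b, - (a + b)), (- (a + b), a), (- b, - a)]"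
    have dist: "distinct os"
      using 4 by (auto simp: os_def a_def b_def complex_eq_iff)
    show ?thesis
    proof (rule ex[OF pf])
      fix c P \<theta> assume *: "invertible P" "sl3_elem c = P ** diag_mat \<theta> ** matrix_inv P"
        and sum: "\<theta>$1 + \<theta>$2 + \<theta>$3 = 0"
      have orb: "orbit \<mu> = set os"
        unfolding \<mu> orbit_eq by (simp add: a_def b_def os_def)
      have "(\<Prod>\<nu>\<in>orbit \<mu>. c 0 + wt_at \<nu> \<theta>) = (c 0 + wt_at (a, b) \<theta>) * ((c 0 + wt_at (a + b, - b) \<theta>) *
        ((c 0 + wt_at (- a, a + b) \<theta>) * ((c 0 + wt_at (b, - (a + b)) \<theta>) * ((c 0 + wt_at (- (a + b), a) \<theta>)
          * (c 0 + wt_at (- b, - a) \<theta>)))))"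
        unfolding orb prod.distinct_set_conv_list[OF dist] by (simp add: os_def)
      also have "\<dots> = det (orbit_matrix a b (c 0) (sl3_elem c))"
        unfolding *(2) orbit_matrix_conj[OF *(1)] det_conj[OF *(1)] det_orbit_matrix_diag[OF sum]
          wt_at_sum_zero[OF sum, where a = a and b = b] by (simp add: mult_ac add_diff_eq)
      finally show "det (orbit_matrix a b (c 0) (sl3_elem c)) = (\<Prod>\<nu>\<in>orbit \<mu>. c 0 + wt_at \<nu> \<theta>)" by simp
    qed
  qed
qed

text \<open>Resolves the \<open>THE\<close>: existence comes from the explicit determinants,
  uniqueness from density of the diagonalizable matrices.\<close>

lemma orbital_factor_eval:
  assumes "dominant \<mu>" "invertible P" "sl3_elem c = P ** diag_mat \<theta> ** matrix_inv P"
  shows "mpoly_eval (orbital_factor \<mu>) c = (\<Prod>\<nu>\<in>orbit \<mu>. c 0 + wt_at \<nu> \<theta>)"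
proof -
  have "\<exists>!p. \<forall>c P \<theta>. invertible P \<and> sl3_elem c = P ** diag_mat \<theta> ** matrix_inv P
      \<longrightarrow> mpoly_eval p c = (\<Prod>\<nu>\<in>orbit \<mu>. c 0 + wt_at \<nu> \<theta>)"
    by (rule ex_ex1I[OF orbital_factor_exists[OF assms(1)]], rule mpoly_eqI_diagonalizable) simp
  from theI'[OF this] show ?thesis
    using assms(2,3) unfolding orbital_factor_def by blast
qed

section \<open>Homogeneity and degree of the orbital factors\<close>

abbreviation monom_degree :: "(nat \<Rightarrow>\<^sub>0 nat) \<Rightarrow> nat" where
  "monom_degree m \<equiv> \<Sum>i\<in>Poly_Mapping.keys m. Poly_Mapping.lookup m i"

text \<open>Scaling by t = 2: weighting the coefficient of each monomial by 2 to its degree, or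
  uniformly by 2^k, gives polynomials that agree on diagonalizable matrices. They are equal, so
  2^degree = 2^k for every monomial that occurs.\<close>

lemma homogeneous_monom_degree:
  assumes hom: "\<And>t c P \<theta>. invertible P \<Longrightarrow> sl3_elem c = P ** diag_mat \<theta> ** matrix_inv P
      \<Longrightarrow> mpoly_eval p (\<lambda>i. t * c i) = t ^ k * mpoly_eval p c"
    and "m \<in> Poly_Mapping.keys p"
  shows "monom_degree m = k"
proof -
  let ?s = "\<lambda>g. \<Sum>m\<in>Poly_Mapping.keys p. Poly_Mapping.single m (Poly_Mapping.lookup p m * g m)"
  have lk: "Poly_Mapping.lookup (?s g) m = Poly_Mapping.lookup p m * g m" for g
    using assms(2) by (simp add: lookup_sum lookup_single when_def)
  have "?s (\<lambda>m. 2 ^ monom_degree m) = ?s (\<lambda>_. 2 ^ k)"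
  proof (rule mpoly_eqI_diagonalizable)
    fix c P \<theta> assume *: "invertible P" "sl3_elem c = P ** diag_mat \<theta> ** matrix_inv P"
    have "monom_eval m (\<lambda>i. 2 * c i) = 2 ^ monom_degree m * monom_eval m c" for m
      by (simp add: monom_eval_def power_mult_distrib prod.distrib power_sum)
    then have "mpoly_eval (?s (\<lambda>m. 2 ^ monom_degree m)) c = mpoly_eval p (\<lambda>i. 2 * c i)"
      by (simp add: mpoly_eval_sum mpoly_eval_single mpoly_eval_superset[of "Poly_Mapping.keys p" p] mult_ac)
    also have "\<dots> = 2 ^ k * mpoly_eval p c" by (rule hom[OF *])
    also have "\<dots> = mpoly_eval (?s (\<lambda>_. 2 ^ k)) c"
      by (simp add: mpoly_eval_sum mpoly_eval_single sum_distrib_left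
          mpoly_eval_superset[of "Poly_Mapping.keys p" p] mult_ac)
    finally show "mpoly_eval (?s (\<lambda>m. 2 ^ monom_degree m)) c = mpoly_eval (?s (\<lambda>_. 2 ^ k)) c" .
  qed
  then have "Poly_Mapping.lookup (?s (\<lambda>m. 2 ^ monom_degree m)) m = Poly_Mapping.lookup (?s (\<lambda>_. 2 ^ k)) m"
    by simp
  then have "Poly_Mapping.lookup p m * 2 ^ monom_degree m = Poly_Mapping.lookup p m * 2 ^ k"
    unfolding lk .
  then have "(2::complex) ^ monom_degree m = 2 ^ k" using assms(2) by (simp add: in_keys_iff)
  then have "cmod (2 ^ monom_degree m) = cmod (2 ^ k)" by simp
  then show ?thesis by (simp add: norm_power)
qed

text \<open>At L = 0 all weights take the value 0. This point later witnesses that the orbital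
  factor is nonzero and not a unit.\<close>

lemma orbital_factor_0:
  assumes "dominant \<mu>"
  shows "mpoly_eval (orbital_factor \<mu>) (\<lambda>i. if i = 0 then z else 0) = z ^ card (orbit \<mu>)"
proof -
  have "sl3_elem (\<lambda>i. if i = 0 then z else 0) = mat 1 ** diag_mat 0 ** matrix_inv (mat 1)"
  proof -
    have "diag_mat 0 = 0" by (simp add: vec_eq_iff diag_mat_nth)
    moreover have "sl3_elem (\<lambda>i. if i = 0 then z else 0) = 0" by (simp add: vec_eq_iff forall_3)
    ultimately show ?thesis by (simp add: vec_eq_iff matrix_matrix_mult_def)
  qed
  moreover have "invertible (mat 1 :: complex^3^3)" by (simp add: invertible_det_nz)
  ultimately show ?thesis using orbital_factor_eval[OF assms] by (simp add: wt_at_def)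
qed

lemma total_degree_orbital_factor:
  assumes "dominant \<mu>"
  shows "total_degree (orbital_factor \<mu>) = card (orbit \<mu>)"
proof -
  let ?f = "orbital_factor \<mu>"
  have deg: "monom_degree m = card (orbit \<mu>)" if "m \<in> Poly_Mapping.keys ?f" for m
  proof (rule homogeneous_monom_degree[OF _ that])
    fix t c P \<theta> assume *: "invertible P" "sl3_elem c = P ** diag_mat \<theta> ** matrix_inv P"
    have "sl3_elem (\<lambda>i. t * c i) = mscale t (sl3_elem c)"
      by (simp add: vec_eq_iff forall_3 mscale_def algebra_simps)
    also have "\<dots> = P ** diag_mat (t *s \<theta>) ** matrix_inv P"
    proof -
      have "mscale t (diag_mat \<theta>) = diag_mat (t *s \<theta>)"
        by (simp add: vec_eq_iff mscale_def diag_mat_nth)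
      then show ?thesis by (simp add: *(2) conj_mscale[OF *(1), symmetric])
    qed
    finally have "mpoly_eval ?f (\<lambda>i. t * c i) = (\<Prod>\<nu>\<in>orbit \<mu>. t * (c 0 + wt_at \<nu> \<theta>))"
      by (subst orbital_factor_eval[OF assms *(1)]) (auto simp: wt_at_def algebra_simps)
    then show "mpoly_eval ?f (\<lambda>i. t * c i) = t ^ card (orbit \<mu>) * mpoly_eval ?f c"
      by (simp add: prod.distrib orbital_factor_eval[OF assms *])
  qed
  \<comment> \<open>With empty support, \<open>total_degree\<close> would return its default value
    0.\<close>
  have "Poly_Mapping.keys ?f \<noteq> {}"
  proof
    assume "Poly_Mapping.keys ?f = {}"
    then have "mpoly_eval ?f (\<lambda>i. if i = 0 then 1 else 0) = 0" by (simp add: mpoly_eval_def)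
    then show False using orbital_factor_0[OF assms, of 1] by simp
  qed
  moreover have "monom_degree ` Poly_Mapping.keys ?f = (\<lambda>_. card (orbit \<mu>)) ` Poly_Mapping.keys ?f"
    by (rule image_cong) (auto simp: deg)
  ultimately have "monom_degree ` Poly_Mapping.keys ?f = {card (orbit \<mu>)}"
    by (simp add: image_constant_conv)
  then show ?thesis by (simp add: total_degree_def)
qed

section \<open>Irreducibility of the orbital factors\<close>

text \<open>Each - r i is a root of G or of H, and the monic factor is divided out of whichever
  vanishes. This works over any domain and is applied with coefficients in C[t].\<close>

lemma factor_prod_linear:
  fixes G H :: "'a::idom poly"
  assumes "finite I" "G * H = (\<Prod>i\<in>I. [:r i, 1:])"
  shows "\<exists>S a b. S \<subseteq> I \<and> a * b = 1 \<and> G = smult a (\<Prod>i\<in>S. [:r i, 1:]) \<and> H = smult b (\<Prod>i\<in>I - S. [:r i, 1:])"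
  using assms
proof (induction I arbitrary: G H rule: finite_induct)
  case empty
  then have GH: "G * H = 1" by simp
  then have "degree G = 0" "degree H = 0"
    by (metis GH degree_mult_eq_0 degree_1 mult_zero_left mult_zero_right zero_neq_one)+
  then obtain a b where "G = [:a:]" "H = [:b:]" by (metis degree_eq_zeroE)
  moreover from this GH have "a * b = 1" by (simp add: one_pCons mult.commute)
  ultimately show ?case by (intro exI[of _ "{}"] exI[of _ a] exI[of _ b]) simp
next
  case (insert i I)
  \<comment> \<open>The case where G has the root; the other case follows by exchanging G and H and
    taking the complement of S.\<close>
  have *: "\<exists>S a b. S \<subseteq> insert i I \<and> i \<in> S \<and> a * b = 1 \<and> G = smult a (\<Prod>i\<in>S. [:r i, 1:])
      \<and> H = smult b (\<Prod>i\<in>insert i I - S. [:r i, 1:])"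
    if GH: "G * H = (\<Prod>i\<in>insert i I. [:r i, 1:])" and root: "poly G (- r i) = 0" for G H
  proof -
    obtain G' where G': "G = [:r i, 1:] * G'"
      using root by (auto simp: poly_eq_0_iff_dvd elim: dvdE)
    have "[:r i, 1:] * (G' * H) = [:r i, 1:] * (\<Prod>i\<in>I. [:r i, 1:])"
      using GH unfolding G' by (simp only: mult.assoc prod.insert[OF insert.hyps])
    then have "G' * H = (\<Prod>i\<in>I. [:r i, 1:])"
      by (subst (asm) mult_cancel_left) auto
    from insert.IH[OF this] obtain S a b where S: "S \<subseteq> I" "a * b = 1"
      "G' = smult a (\<Prod>i\<in>S. [:r i, 1:])" "H = smult b (\<Prod>i\<in>I - S. [:r i, 1:])" by blast
    have "finite S" "i \<notin> S" using S(1) insert.hyps finite_subset by auto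
    moreover have "insert i I - insert i S = I - S" using insert.hyps by auto
    ultimately show ?thesis
      using S by (intro exI[of _ "insert i S"] exI[of _ a] exI[of _ b]) (auto simp: G' mult_smult_right)
  qed
  have "poly (G * H) (- r i) = 0"
    unfolding insert.prems using insert.hyps by (simp add: poly_prod)
  then consider "poly G (- r i) = 0" | "poly H (- r i) = 0" by auto
  then show ?case
  proof cases
    case 1
    then show ?thesis using *[OF insert.prems] by blast
  next
    case 2
    have "H * G = (\<Prod>i\<in>insert i I. [:r i, 1:])" using insert.prems by (simp only: mult.commute)
    from *[OF this 2] obtain S a b where S: "S \<subseteq> insert i I" "a * b = 1"
      "H = smult a (\<Prod>i\<in>S. [:r i, 1:])" "G = smult b (\<Prod>i\<in>insert i I - S. [:r i, 1:])" by blast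
    moreover have "insert i I - (insert i I - S) = S" using S(1) by auto
    ultimately show ?thesis
      by (intro exI[of _ "insert i I - S"] exI[of _ b] exI[of _ a]) (auto simp: mult.commute)
  qed
qed

lemma poly_unit_const:
  fixes p q :: "complex poly"
  assumes "p * q = 1"
  shows "\<exists>a. a \<noteq> 0 \<and> p = [:a:]"
proof -
  have "p dvd 1" using assms by (metis dvd_triv_left)
  then show ?thesis by (auto simp: is_unit_poly_iff)
qed

lemma poly_map_poly_eval: "poly (map_poly (\<lambda>q. poly q t) F) z = poly2 F z t"
  by (induction F) (auto simp: poly2_def map_poly_pCons)

lemma wt_at_theta0: "wt_at \<nu> theta0 = fst \<nu> + snd \<nu> * \<i>"
  by (simp add: wt_at_def theta0_def algebra_simps)

lemma orbit_real:
  assumes "dominant \<mu>" "\<nu> \<in> orbit \<mu>"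
  shows "fst \<nu> \<in> \<real>" "snd \<nu> \<in> \<real>"
proof -
  have "fst \<mu> \<in> \<real>" "snd \<mu> \<in> \<real>" using assms(1) by (auto simp: dominant_def elim!: Nats_cases)
  then show "fst \<nu> \<in> \<real>" "snd \<nu> \<in> \<real>"
    using assms(2) by (cases \<mu>; auto simp: orbit_eq)+
qed

lemma wt_at_theta0_inj:
  assumes "fst \<mu> \<in> \<real>" "snd \<mu> \<in> \<real>" "fst \<nu> \<in> \<real>" "snd \<nu> \<in> \<real>" "wt_at \<mu> theta0 = wt_at \<nu> theta0"
  shows "\<mu> = \<nu>"
  using assms by (cases \<mu>; cases \<nu>) (auto simp: wt_at_theta0 complex_eq_iff complex_is_Real_iff)

lemma companion_permute:
  assumes "\<sigma> permutes UNIV"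
  shows "companion (\<chi> i. \<theta> $ \<sigma> i) = companion \<theta>"
  using permutes_3_cases[OF assms] by (auto simp: companion_def fun_eq_iff mult_ac add_ac)

text \<open>The set S is independent of the point on the segment because the factorisation is
  carried out over C[t]. The two endpoints have the same companion coordinates, whence two product
  formulas for one and the same function of z.\<close>

lemma orbital_factor_companion_line:
  assumes dom: "dominant \<mu>" and gh: "orbital_factor \<mu> = g * h" and \<sigma>: "\<sigma> permutes UNIV"
  shows "\<exists>S a b. S \<subseteq> orbit \<mu> \<and> a \<noteq> 0 \<and> b \<noteq> 0 \<and>
    (\<forall>z. mpoly_eval g ((companion theta0)(0 := z)) = a * (\<Prod>\<nu>\<in>S. z + wt_at \<nu> theta0)) \<and>
    (\<forall>z. mpoly_eval g ((companion theta0)(0 := z)) = a * (\<Prod>\<nu>\<in>S. z + wt_at (weyl_act \<sigma> \<nu>) theta0)) \<and>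
    (\<forall>z. mpoly_eval h ((companion theta0)(0 := z)) = b * (\<Prod>\<nu>\<in>orbit \<mu> - S. z + wt_at \<nu> theta0))"
proof -
  define l where "l i = [:theta0 $ i, theta0 $ \<sigma> i - theta0 $ i:]" for i
  define \<theta> :: "complex \<Rightarrow> complex^3" where "\<theta> t = (\<chi> i. poly (l i) t)" for t
  have \<theta>01: "\<theta> 0 = theta0" "\<theta> 1 = (\<chi> i. theta0 $ \<sigma> i)"
    by (simp_all add: \<theta>_def l_def vec_eq_iff)
  have sum_perm: "theta0 $ \<sigma> 1 + theta0 $ \<sigma> 2 + theta0 $ \<sigma> 3 = 0"
    using permutes_3_cases[OF \<sigma>] theta0(1) by (auto simp: add_ac)
  have sum0: "\<theta> t $ 1 + \<theta> t $ 2 + \<theta> t $ 3 = 0" for t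
  proof -
    have "\<theta> t $ 1 + \<theta> t $ 2 + \<theta> t $ 3 = (1 - t) * (theta0$1 + theta0$2 + theta0$3)
       + t * (theta0 $ \<sigma> 1 + theta0 $ \<sigma> 2 + theta0 $ \<sigma> 3)"
      by (simp add: \<theta>_def l_def algebra_simps)
    then show ?thesis by (simp only: sum_perm theta0 mult_zero_right add_0)
  qed
  \<comment> \<open>Where two eigenvalues collide, \<open>companion_diagonalizable\<close> does not
    apply; these finitely many parameters are left out when polynomials in t are compared.\<close>
  define T where "T = {t. \<not> inj (\<lambda>i. \<theta> t $ i)}"
  have "finite T"
  proof (rule finite_subset)
    show "T \<subseteq> (\<Union>i. \<Union>j\<in>- {i}. {t. poly (l i - l j) t = 0})"
    proof
      fix t assume "t \<in> T"
      then obtain i j where "i \<noteq> j" "poly (l i) t = poly (l j) t"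
        unfolding T_def inj_def \<theta>_def by auto
      then show "t \<in> (\<Union>i. \<Union>j\<in>- {i}. {t. poly (l i - l j) t = 0})" by force
    qed
    have "l i - l j \<noteq> 0" if "i \<noteq> j" for i j
    proof
      assume "l i - l j = 0"
      then have "poly (l i) 0 = poly (l j) 0" by simp
      then have "theta0 $ i = theta0 $ j" by (simp add: l_def)
      then show False using injD[OF theta0(2), of i j] that by simp
    qed
    then show "finite (\<Union>i. \<Union>j\<in>- {i}. {t. poly (l i - l j) t = 0})"
      by (intro finite_UN_I finite poly_roots_finite) simp_all
  qed
  \<comment> \<open>The companion coordinates along the segment as elements of C[t][z_0], with
    coordinate 0 equal to z_0.\<close>
  define X :: "nat \<Rightarrow> complex poly poly" where
    "X k = (if k = 0 then [:0, 1:] else if k = 3 \<or> k = 6 then 1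
     else if k = 7 then [:l 1 * l 2 * l 3:]
     else if k = 8 then [:- (l 1 * l 2 + l 1 * l 3 + l 2 * l 3):] else 0)" for k
  have X: "(\<lambda>k. poly2 (X k) z t) = (companion (\<theta> t))(0 := z)" for z t
    by (auto simp: fun_eq_iff X_def companion_def \<theta>_def poly2_def)
  obtain G where G: "\<And>z t. mpoly_eval g ((companion (\<theta> t))(0 := z)) = poly2 G z t"
    using mpoly_eval_poly2[of g X] unfolding X by blast
  obtain H where H: "\<And>z t. mpoly_eval h ((companion (\<theta> t))(0 := z)) = poly2 H z t"
    using mpoly_eval_poly2[of h X] unfolding X by blast
  define w where "w \<nu> = smult (fst \<nu>) (l 1) + smult (snd \<nu>) (l 1 + l 2)" for \<nu>
  have w: "poly (w \<nu>) t = wt_at \<nu> (\<theta> t)" for \<nu> t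
    by (simp add: w_def wt_at_def \<theta>_def)
  have "G * H = (\<Prod>\<nu>\<in>orbit \<mu>. [:w \<nu>, 1:])"
  proof (rule poly2_eqI[OF \<open>finite T\<close>])
    fix z t assume "t \<notin> T"
    then obtain P where P: "invertible P"
      "sl3_elem ((companion (\<theta> t))(0 := z)) = P ** diag_mat (\<theta> t) ** matrix_inv P"
      using companion_diagonalizable[OF sum0] unfolding T_def by blast
    have "poly2 (G * H) z t = mpoly_eval (orbital_factor \<mu>) ((companion (\<theta> t))(0 := z))"
      by (simp add: poly2_simps G[symmetric] H[symmetric] gh mpoly_eval_mult)
    also have "\<dots> = (\<Prod>\<nu>\<in>orbit \<mu>. z + wt_at \<nu> (\<theta> t))"
      by (simp add: orbital_factor_eval[OF dom P])
    finally show "poly2 (G * H) z t = poly2 (\<Prod>\<nu>\<in>orbit \<mu>. [:w \<nu>, 1:]) z t"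
      by (simp add: poly2_prod poly2_simps w add.commute)
  qed
  from factor_prod_linear[OF finite_orbit this] obtain S p q where S: "S \<subseteq> orbit \<mu>" "p * q = 1"
    "G = smult p (\<Prod>\<nu>\<in>S. [:w \<nu>, 1:])" "H = smult q (\<Prod>\<nu>\<in>orbit \<mu> - S. [:w \<nu>, 1:])"
    by blast
  \<comment> \<open>The cofactors p and q are units of C[t], so the scalars a and b do not vary
    along the segment.\<close>
  obtain a where a: "a \<noteq> 0" "p = [:a:]" using poly_unit_const[OF S(2)] by blast
  obtain b where b: "b \<noteq> 0" "q = [:b:]" using poly_unit_const[of q p] S(2) by (auto simp: mult.commute)
  have g: "mpoly_eval g ((companion (\<theta> t))(0 := z)) = a * (\<Prod>\<nu>\<in>S. z + wt_at \<nu> (\<theta> t))" for z t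
    unfolding G S(3) a(2) by (simp add: poly2_simps poly2_prod w add.commute)
  have h: "mpoly_eval h ((companion (\<theta> t))(0 := z)) = b * (\<Prod>\<nu>\<in>orbit \<mu> - S. z + wt_at \<nu> (\<theta> t))" for z t
    unfolding H S(4) b(2) by (simp add: poly2_simps poly2_prod w add.commute)
  show ?thesis
    using g[of 0] g[of 1] h[of 0] S(1) a(1) b(1) unfolding \<theta>01 companion_permute[OF \<sigma>]
    by (intro exI[of _ S] exI[of _ a] exI[of _ b]) (simp add: wt_at_weyl_act[OF \<sigma> theta0(1)])
qed

lemma orbital_factor_companion_const:
  assumes dom: "dominant \<mu>" and gh: "orbital_factor \<mu> = g * h"
  shows "(\<exists>a. \<forall>z. mpoly_eval g ((companion theta0)(0 := z)) = a)
    \<or> (\<exists>b. \<forall>z. mpoly_eval h ((companion theta0)(0 := z)) = b)"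
proof -
  \<comment> \<open>The set supplied by \<open>orbital_factor_companion_line\<close> might depend on
    the permutation. S is read off from the zeros of g instead, and \<open>S_eq\<close> identifies
    every supplied set with it because \<open>theta0\<close> separates the orbit.\<close>
  define S where "S = {\<nu>\<in>orbit \<mu>. mpoly_eval g ((companion theta0)(0 := - wt_at \<nu> theta0)) = 0}"
  have inj: "\<nu> = \<nu>'" if "\<nu> \<in> orbit \<mu>" "\<nu>' \<in> orbit \<mu>" "wt_at \<nu> theta0 = wt_at \<nu>' theta0" for \<nu> \<nu>'
    using that orbit_real[OF dom] by (intro wt_at_theta0_inj) auto
  have S_eq: "S' = S" if "S' \<subseteq> orbit \<mu>" "a \<noteq> 0"
    "\<And>z. mpoly_eval g ((companion theta0)(0 := z)) = a * (\<Prod>\<nu>\<in>S'. z + wt_at \<nu> theta0)" for S' a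
  proof -
    have "finite S'" using that(1) finite_orbit finite_subset by blast
    then have "\<nu> \<in> S \<longleftrightarrow> \<nu> \<in> orbit \<mu> \<and> (\<exists>\<nu>'\<in>S'. wt_at \<nu>' theta0 = wt_at \<nu> theta0)" for \<nu>
      unfolding S_def that(3) using that(2) by (auto simp: neg_eq_iff_add_eq_0)
    then show ?thesis using inj that(1) by blast
  qed
  have closed: "weyl_act \<sigma> \<nu> \<in> S" if \<sigma>: "\<sigma> permutes UNIV" and \<nu>: "\<nu> \<in> S" for \<sigma> \<nu>
  proof -
    obtain S' a where S': "S' \<subseteq> orbit \<mu>" "a \<noteq> 0"
      "\<And>z. mpoly_eval g ((companion theta0)(0 := z)) = a * (\<Prod>\<nu>\<in>S'. z + wt_at \<nu> theta0)"
      "\<And>z. mpoly_eval g ((companion theta0)(0 := z)) = a * (\<Prod>\<nu>\<in>S'. z + wt_at (weyl_act \<sigma> \<nu>) theta0)"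
      using orbital_factor_companion_line[OF dom gh \<sigma>] by blast
    have "S' = S" using S_eq[OF S'(1-3)] .
    have "weyl_act \<sigma> \<nu> \<in> orbit \<nu>" using \<sigma> unfolding orbit_def by blast
    then have "weyl_act \<sigma> \<nu> \<in> orbit \<mu>" using \<nu> orbit_eqI[of \<nu> \<mu>] unfolding S_def by auto
    moreover have "finite S" unfolding S_def by simp
    then have "mpoly_eval g ((companion theta0)(0 := - wt_at (weyl_act \<sigma> \<nu>) theta0)) = 0"
      unfolding S'(4) \<open>S' = S\<close> using \<nu> by auto
    ultimately show ?thesis unfolding S_def by simp
  qed
  obtain S' a b where S': "S' \<subseteq> orbit \<mu>" "a \<noteq> 0"
    and g: "\<And>z. mpoly_eval g ((companion theta0)(0 := z)) = a * (\<Prod>\<nu>\<in>S'. z + wt_at \<nu> theta0)"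
    and h: "\<And>z. mpoly_eval h ((companion theta0)(0 := z)) = b * (\<Prod>\<nu>\<in>orbit \<mu> - S'. z + wt_at \<nu> theta0)"
    using orbital_factor_companion_line[OF dom gh permutes_id] by blast
  have S'S: "S' = S" using S_eq[OF S' g] .
  show ?thesis
  proof (cases "S = {}")
    case True
    then show ?thesis using g S'S by simp
  next
    case False
    then obtain \<nu> where \<nu>: "\<nu> \<in> S" by blast
    then have "orbit \<nu> = orbit \<mu>" using orbit_eqI unfolding S_def by blast
    moreover have "orbit \<nu> \<subseteq> S"
      unfolding orbit_def by (auto intro: closed[OF _ \<nu>])
    ultimately have "orbit \<mu> \<subseteq> S" by simp
    then have "orbit \<mu> - S' = {}" using S'S by blast
    then have "mpoly_eval h ((companion theta0)(0 := z)) = b" for z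
      unfolding h by (simp only: prod.empty mult_1_right)
    then show ?thesis by blast
  qed
qed

text \<open>At each diagonalizable point of the line F specialises to a monic polynomial whose
  degree is the size of the orbit. So the coefficients of F from that degree upwards equal 1, 0, 0,
  ... for cofinitely many t, hence identically.\<close>

lemma orbital_factor_line_monic:
  assumes dom: "dominant \<mu>" and disc: "disc (sl3_elem c') \<noteq> 0"
    and F: "\<And>z t. mpoly_eval (orbital_factor \<mu>) ((\<lambda>i. c i + t * (c' i - c i))(0 := z)) = poly2 F z t"
  shows "lead_coeff F = 1"
proof -
  let ?l = "\<lambda>t i. c i + t * (c' i - c i)"
  let ?k = "card (orbit \<mu>)"
  define T where "T = {t. disc (sl3_elem (?l t)) = 0}"
  have T: "finite T" unfolding T_def by (rule finite_disc_zero_on_line[OF disc])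
  have cf: "poly (coeff F j) t = (if j = ?k then 1 else 0)" if tT: "t \<notin> T" and jk: "j \<ge> ?k" for t j
  proof -
    have e: "sl3_elem ((?l t)(0 := z)) = sl3_elem (?l t)" for z
      by (simp add: vec_eq_iff forall_3)
    obtain P \<theta> where P: "invertible P" "sl3_elem (?l t) = P ** diag_mat \<theta> ** matrix_inv P"
      using sl3_diagonalizable[OF sl3_elem_in_sl3, of "?l t"] tT unfolding T_def by blast
    define Q where "Q = (\<Prod>\<nu>\<in>orbit \<mu>. [:wt_at \<nu> \<theta>, 1:])"
    have "poly (map_poly (\<lambda>q. poly q t) F) z = poly Q z" for z
    proof -
      have "poly (map_poly (\<lambda>q. poly q t) F) z = mpoly_eval (orbital_factor \<mu>) ((?l t)(0 := z))"
        by (simp add: poly_map_poly_eval F)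
      also have "\<dots> = (\<Prod>\<nu>\<in>orbit \<mu>. z + wt_at \<nu> \<theta>)"
        by (subst orbital_factor_eval[OF dom P(1)]) (simp_all add: e P(2))
      also have "\<dots> = poly Q z" by (simp add: Q_def poly_prod add.commute)
      finally show ?thesis .
    qed
    then have "map_poly (\<lambda>q. poly q t) F = Q" by (simp add: poly_eq_poly_eq_iff[symmetric] fun_eq_iff)
    then have "poly (coeff F j) t = coeff Q j" by (metis coeff_map_poly poly_0)
    moreover have "degree Q = ?k" by (simp add: Q_def degree_prod_eq_sum_degree)
    moreover have "lead_coeff Q = 1" unfolding Q_def by (subst lead_coeff_prod) simp
    ultimately show ?thesis using jk by (auto simp: coeff_eq_0)
  qed
  have "coeff F j - (if j = ?k then 1 else 0) = 0" if "j \<ge> ?k" for j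
    by (rule poly_eq_0_cofinite[OF T]) (simp add: cf that)
  then have co: "coeff F j = (if j = ?k then 1 else 0)" if "j \<ge> ?k" for j using that by simp
  then have "degree F = ?k"
    by (intro antisym degree_le le_degree) auto
  then show ?thesis using co by simp
qed

text \<open>On a line from an arbitrary c to the companion matrix the restrictions satisfy
  lead_coeff G * lead_coeff H = 1 in C[t], so G has a constant leading coefficient and the same
  z_0-degree at every t. At t = 1 this degree is 0, hence g takes the value a at c too.\<close>

lemma orbital_factor_unit_factor:
  assumes dom: "dominant \<mu>" and gh: "orbital_factor \<mu> = g * h"
    and const: "\<And>z. mpoly_eval g ((companion theta0)(0 := z)) = a"
  shows "g dvd 1"
proof -
  have ev: "mpoly_eval g c = a" for c
  proof -
    let ?c' = "companion theta0"
    let ?l = "\<lambda>t i. c i + t * (?c' i - c i)"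
    define X :: "nat \<Rightarrow> complex poly poly" where
      "X i = (if i = 0 then [:0, 1:] else [:[:c i, ?c' i - c i:]:])" for i
    have X: "(\<lambda>i. poly2 (X i) z t) = (?l t)(0 := z)" for z t
      by (auto simp: fun_eq_iff X_def poly2_def)
    obtain G where G: "\<And>z t. mpoly_eval g ((?l t)(0 := z)) = poly2 G z t"
      using mpoly_eval_poly2[of g X] unfolding X by blast
    obtain H where H: "\<And>z t. mpoly_eval h ((?l t)(0 := z)) = poly2 H z t"
      using mpoly_eval_poly2[of h X] unfolding X by blast
    have "lead_coeff (G * H) = 1"
      by (rule orbital_factor_line_monic[OF dom disc_companion[OF theta0], of c])
         (simp add: gh mpoly_eval_mult poly2_simps G H)
    then have "lead_coeff G * lead_coeff H = 1" by (simp add: lead_coeff_mult)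
    then obtain b where b: "b \<noteq> 0" "lead_coeff G = [:b:]" using poly_unit_const by blast
    define Q where "Q = map_poly (\<lambda>q. poly q 1) G"
    have "poly Q z = poly [:a:] z" for z
    proof -
      have "(?l 1)(0 := z) = ?c'(0 := z)" by (auto simp: fun_eq_iff)
      then show ?thesis using G[of 1 z] const[of z] by (simp add: Q_def poly_map_poly_eval)
    qed
    then have "Q = [:a:]" by (simp add: poly_eq_poly_eq_iff[symmetric] fun_eq_iff)
    moreover have "coeff Q (degree G) = b"
      using b(2) unfolding Q_def by (subst coeff_map_poly) auto
    ultimately have "degree G = 0" using b(1) by (cases "degree G") auto
    then have "G = [:[:b:]:]" using b(2) by (auto elim: degree_eq_zeroE)
    then have b_eq: "mpoly_eval g ((?l t)(0 := z)) = b" for t z using G by (simp add: poly2_simps)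
    have "(?l 0)(0 := c 0) = c" "(?l 1)(0 := 0) = ?c'(0 := 0)" by (auto simp: fun_eq_iff)
    then show ?thesis using b_eq[of 0 "c 0"] b_eq[of 1 0] const[of 0] by simp
  qed
  have "a \<noteq> 0"
  proof
    assume "a = 0"
    then have "mpoly_eval (orbital_factor \<mu>) (\<lambda>i. if i = 0 then 1 else 0) = 0"
      by (simp add: gh mpoly_eval_mult ev)
    then show False using orbital_factor_0[OF dom, of 1] by simp
  qed
  then have "g * Poly_Mapping.single 0 (1 / a) = 1"
    by (intro mpoly_eqI) (simp add: mpoly_eval_mult mpoly_eval_single ev)
  then show ?thesis by (metis dvd_triv_left)
qed

lemma irreducible_orbital_factor:
  assumes dom: "dominant \<mu>"
  shows "irreducible (orbital_factor \<mu>)"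
proof (rule irreducibleI)
  show "orbital_factor \<mu> \<noteq> 0" using orbital_factor_0[OF dom, of 1] by auto
  show "\<not> orbital_factor \<mu> dvd 1"
  proof
    assume "orbital_factor \<mu> dvd 1"
    then obtain h where "1 = orbital_factor \<mu> * h" by (rule dvdE)
    \<comment> \<open>The zero point, written in the shape of \<open>orbital_factor_0\<close>: the
      orbital factor vanishes there since the orbit is nonempty.\<close>
    then have "1 = mpoly_eval (orbital_factor \<mu> * h) (\<lambda>i. if i = 0 then 0 else 0)" by simp
    also have "\<dots> = 0 ^ card (orbit \<mu>) * mpoly_eval h (\<lambda>i. if i = 0 then 0 else 0)"
      by (simp only: mpoly_eval_mult orbital_factor_0[OF dom])
    finally have "card (orbit \<mu>) = 0" by (cases "card (orbit \<mu>)") auto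
    then show False using mem_orbit_self[of \<mu>] by auto
  qed
  fix g h assume gh: "orbital_factor \<mu> = g * h"
  then have hg: "orbital_factor \<mu> = h * g" by (simp only: mult.commute)
  from orbital_factor_companion_const[OF dom gh] show "g dvd 1 \<or> h dvd 1"
    using orbital_factor_unit_factor[OF dom gh] orbital_factor_unit_factor[OF dom hg] by blast
qed

section \<open>Conjugation invariance\<close>

lemma sl3_elem_add: "sl3_elem (\<lambda>k. c k + d k) = sl3_elem c + sl3_elem d"
  by (simp add: vec_eq_iff forall_3)

lemma sl3_elem_mscale: "sl3_elem (\<lambda>k. a * c k) = mscale a (sl3_elem c)"
  by (simp add: vec_eq_iff forall_3 mscale_def algebra_simps)

lemma basis_elem_in_sl3 [simp, intro]: "basis_elem k \<in> sl3"
  by (simp add: basis_elem_def)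

lemma mscale_0 [simp]: "mscale 0 X = 0"
  by (simp add: mscale_def vec_eq_iff)

text \<open>The entries of \<open>\<phi> L\<close> are linear forms in the coordinates of L; both
  the polynomiality of the determinant and the differentiability of \<open>\<phi>\<close> along
  curves rest on this.\<close>

lemma rep_sl3_elem:
  assumes "is_rep \<phi>"
  shows "\<phi> (sl3_elem c) $ i $ j = (\<Sum>k=1..8. c k * \<phi> (basis_elem k) $ i $ j)"
proof -
  have *: "\<phi> (sl3_elem (\<lambda>k. if k \<in> A then c k else 0)) $ i $ j = (\<Sum>k\<in>A. c k * \<phi> (basis_elem k) $ i $ j)"
    if "finite A" for A
    using that
  proof (induction A rule: finite_induct)
    case empty
    have "sl3_elem (\<lambda>k. 0) = mscale 0 (sl3_elem (\<lambda>k. 0))" by (simp add: vec_eq_iff forall_3)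
    then have "\<phi> (sl3_elem (\<lambda>k. 0)) = mscale 0 (\<phi> (sl3_elem (\<lambda>k. 0)))"
      using assms sl3_elem_in_sl3 unfolding is_rep_def by metis
    then show ?case by simp
  next
    case (insert x A)
    have "(\<lambda>k. if k \<in> insert x A then c k else 0)
      = (\<lambda>k. c x * (if k = x then 1 else 0) + (if k \<in> A then c k else 0))"
      using insert.hyps by (auto simp: fun_eq_iff)
    then have "sl3_elem (\<lambda>k. if k \<in> insert x A then c k else 0) =
      mscale (c x) (basis_elem x) + sl3_elem (\<lambda>k. if k \<in> A then c k else 0)"
      by (simp only: sl3_elem_add sl3_elem_mscale basis_elem_def)
    moreover have "mscale (c x) (basis_elem x) \<in> sl3"
      unfolding basis_elem_def sl3_elem_mscale[symmetric] by simp
    ultimately have "\<phi> (sl3_elem (\<lambda>k. if k \<in> insert x A then c k else 0)) =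
      mscale (c x) (\<phi> (basis_elem x)) + \<phi> (sl3_elem (\<lambda>k. if k \<in> A then c k else 0))"
      using assms unfolding is_rep_def by simp
    then show ?case using insert by (simp add: mscale_def)
  qed
  have "sl3_elem c = sl3_elem (\<lambda>k. if k \<in> {1..8} then c k else 0)"
    by (simp add: vec_eq_iff forall_3)
  then show ?thesis using *[of "{1..8}"] by simp
qed

definition sl3_coords :: "complex^3^3 \<Rightarrow> nat \<Rightarrow> complex" where
  "sl3_coords X k = (if k = 1 then X$1$1 else if k = 2 then - X$3$3 else if k = 3 then X$1$2
     else if k = 4 then X$1$3 else if k = 5 then X$2$1 else if k = 6 then X$2$3
     else if k = 7 then X$3$1 else X$3$2)"

lemma sl3_elem_coords: "X \<in> sl3 \<Longrightarrow> sl3_elem (sl3_coords X) = X"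
proof -
  assume "X \<in> sl3"
  then have X: "X$2$2 = - X$1$1 - X$3$3" by (simp add: sl3_def trace_3 algebra_simps eq_neg_iff_add_eq_0)
  show ?thesis by (simp add: vec_eq_iff forall_3 sl3_coords_def X)
qed

section \<open>Complex derivatives of matrix-valued functions\<close>

definition has_mat_derivative :: "(complex \<Rightarrow> complex^'m^'n) \<Rightarrow> complex^'m^'n \<Rightarrow> complex \<Rightarrow> bool" where
  "has_mat_derivative M M' s \<longleftrightarrow> (\<forall>i j. ((\<lambda>s. M s $ i $ j) has_field_derivative M' $ i $ j) (at s))"

lemma has_mat_derivative_mult:
  assumes "has_mat_derivative A A' s" "has_mat_derivative B B' s"
  shows "has_mat_derivative (\<lambda>s. A s ** B s) (A' ** B s + A s ** B') s"
  using assms unfolding has_mat_derivative_def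
  by (auto simp: matrix_matrix_mult_def sum.distrib[symmetric] mult.commute intro!: derivative_eq_intros)

lemma has_mat_derivative_add:
  assumes "has_mat_derivative A A' s" "has_mat_derivative B B' s"
  shows "has_mat_derivative (\<lambda>s. A s + B s) (A' + B') s"
  using assms unfolding has_mat_derivative_def by (auto intro!: derivative_eq_intros)

lemma has_mat_derivative_const: "has_mat_derivative (\<lambda>s. A) 0 s"
  by (simp add: has_mat_derivative_def)

lemma has_mat_derivative_unique:
  assumes "has_mat_derivative A A' s" "has_mat_derivative A B' s"
  shows "A' = B'"
  using assms unfolding has_mat_derivative_def vec_eq_iff by (meson DERIV_unique)

lemma has_mat_derivative_linear: "has_mat_derivative (\<lambda>s. A + mscale s B) B s"
  unfolding has_mat_derivative_def mscale_def by (auto intro!: derivative_eq_intros)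

text \<open>The differential of det at X in the direction Y, i.e. trace (adj X ** Y), in the form
  that the product rule gives for the Leibniz formula.\<close>

definition det_differential :: "complex^'n^'n \<Rightarrow> complex^'n^'n \<Rightarrow> complex" where
  "det_differential X Y = (\<Sum>p | p permutes UNIV. of_int (sign p) *
     (\<Sum>i\<in>UNIV. Y $ i $ p i * (\<Prod>j\<in>UNIV - {i}. X $ j $ p j)))"

lemma det_has_derivative:
  assumes "has_mat_derivative M M' s"
  shows "((\<lambda>s. det (M s)) has_field_derivative det_differential (M s) M') (at s)"
  using assms unfolding det_def det_differential_def has_mat_derivative_def
  by (intro DERIV_sum DERIV_cmult has_field_derivative_prod) auto

lemma det_differential_uminus: "det_differential X (- Y) = - det_differential X Y"
  by (simp add: det_differential_def sum_negf)

lemma matrix_mult_diff: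
  "(X::complex^'n^'n) ** (Y - Z) = X ** Y - X ** Z" "(Y - Z) ** X = Y ** X - Z ** X"
  by (simp_all add: matrix_matrix_mult_def vec_eq_iff algebra_simps sum_subtractf)

lemma matrix_mult_uminus:
  "(X::complex^'n^'n) ** (- Y) = - (X ** Y)" "(- Y) ** X = - (Y ** X)"
  by (simp_all add: matrix_matrix_mult_def vec_eq_iff sum_negf)

lemma matrix_mult_zero: "(X::complex^'n^'n) ** 0 = 0"
  by (simp add: matrix_matrix_mult_def vec_eq_iff)

text \<open>The commutator is the velocity at \<open>h = 0\<close> of \<open>(1 + hA) X (1 - hA)\<close>, whose determinant is
  stationary there.\<close>

lemma det_differential_commutator: "det_differential X (A ** X - X ** A) = 0"
proof -
  let ?I = "mat 1 :: complex^'n^'n"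
  define P where "P h = ?I + mscale h A" for h
  define Q where "Q h = ?I + mscale h (- A)" for h
  have P: "has_mat_derivative P A 0" and Q: "has_mat_derivative Q (- A) 0"
    unfolding P_def Q_def by (rule has_mat_derivative_linear)+
  have PQ0: "P 0 = ?I" "Q 0 = ?I" by (simp_all add: P_def Q_def)
  have "has_mat_derivative (\<lambda>h. P h ** X ** Q h) (A ** X - X ** A) 0"
    using has_mat_derivative_mult[OF has_mat_derivative_mult[OF P has_mat_derivative_const[of X]] Q]
    by (simp add: PQ0 matrix_mult_uminus matrix_mult_zero)
  from det_has_derivative[OF this]
  have "((\<lambda>h. det (P h ** X ** Q h)) has_field_derivative det_differential X (A ** X - X ** A)) (at 0)"
    by (simp add: PQ0)
  \<comment> \<open>The first-order terms of det (1 + hA) and det (1 - hA) cancel.\<close>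
  moreover have "((\<lambda>h. det (P h) * det X * det (Q h)) has_field_derivative 0) (at 0)"
    using det_has_derivative[OF P] det_has_derivative[OF Q]
    by (auto intro!: derivative_eq_intros simp: PQ0 det_differential_uminus)
  ultimately show ?thesis unfolding det_mul by (rule DERIV_unique)
qed

text \<open>Cramer's rule gives the inverse as quotients of determinants, which can be
  differentiated; \<open>matrix_inv\<close> is defined by choice.\<close>

definition cramer_inv :: "complex^'n^'n \<Rightarrow> complex^'n^'n" where
  "cramer_inv P = (\<chi> k l. det (\<chi> i j. if j = k then (if i = l then 1 else 0) else P $ i $ j) / det P)"

lemma cramer_inv_right:
  fixes P :: "complex^'n^'n"
  assumes "det P \<noteq> 0"
  shows "P ** cramer_inv P = mat 1"
proof -
  have "(P ** cramer_inv P) $ i $ l = (mat 1 :: complex^'n^'n) $ i $ l" for i l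
  proof -
    let ?b = "(\<chi> i. if i = l then 1 else 0) :: complex^'n"
    have "P *v (\<chi> k. det (\<chi> i j. if j = k then ?b $ i else P $ i $ j) / det P) = ?b"
      using cramer[OF assms] by blast
    then have "P *v (\<chi> k. cramer_inv P $ k $ l) = ?b"
      by (simp add: cramer_inv_def cong: if_cong)
    then have "(P *v (\<chi> k. cramer_inv P $ k $ l)) $ i = ?b $ i" by simp
    then show ?thesis by (simp add: matrix_vector_mult_def matrix_matrix_mult_def mat_def)
  qed
  then show ?thesis by (simp add: vec_eq_iff)
qed

lemma cramer_inv_left: "det P \<noteq> 0 \<Longrightarrow> cramer_inv P ** P = mat 1"
  using cramer_inv_right matrix_left_right_inverse by blast

lemma cramer_inv_eq: "invertible P \<Longrightarrow> cramer_inv P = matrix_inv P"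
  by (metis cramer_inv_left invertible_det_nz matrix_inv_right matrix_mul_assoc matrix_mul_lid matrix_mul_rid)

lemma cramer_inv_has_derivative:
  assumes P: "has_mat_derivative P P' s" and nz: "det (P s) \<noteq> 0"
  shows "\<exists>N'. has_mat_derivative (\<lambda>s. cramer_inv (P s)) N' s"
proof -
  have "\<exists>d. ((\<lambda>s. cramer_inv (P s) $ k $ l) has_field_derivative d) (at s)" for k l
  proof -
    let ?M = "\<lambda>s. (\<chi> i j. if j = k then (if i = l then 1 else 0) else P s $ i $ j)"
    have "has_mat_derivative ?M (\<chi> i j. if j = k then 0 else P' $ i $ j) s"
      using P unfolding has_mat_derivative_def by auto
    from DERIV_divide[OF det_has_derivative[OF this] det_has_derivative[OF P] nz]
    show ?thesis by (auto simp: cramer_inv_def)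
  qed
  then obtain d where "\<And>k l. ((\<lambda>s. cramer_inv (P s) $ k $ l) has_field_derivative d k l) (at s)"
    by metis
  then show ?thesis unfolding has_mat_derivative_def by (intro exI[of _ "\<chi> k l. d k l"]) simp
qed

text \<open>With N the inverse of P, differentiating P N = 1 gives N' = - N P' N. Hence the
  derivative of P D N is the commutator of B = P' N with P D N.\<close>

lemma conj_has_derivative:
  assumes P: "\<And>s. has_mat_derivative P P' s" and S: "open S" "s \<in> S" "\<And>s. s \<in> S \<Longrightarrow> det (P s) \<noteq> 0"
  shows "\<exists>B. has_mat_derivative (\<lambda>s. P s ** D ** cramer_inv (P s))
     (B ** (P s ** D ** cramer_inv (P s)) - (P s ** D ** cramer_inv (P s)) ** B) s"
proof -
  define N where "N s = cramer_inv (P s)" for s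
  obtain N' where N': "has_mat_derivative N N' s"
    using cramer_inv_has_derivative[OF P S(3)[OF S(2)]] unfolding N_def by blast
  have "has_mat_derivative (\<lambda>s. P s ** N s) 0 s"
    unfolding has_mat_derivative_def
  proof (intro allI)
    fix i j
    show "((\<lambda>s. (P s ** N s) $ i $ j) has_field_derivative 0 $ i $ j) (at s)"
      by (rule has_field_derivative_transform_within_open[where f = "\<lambda>s. mat 1 $ i $ j", OF _ S(1,2)])
         (auto simp: N_def cramer_inv_right[OF S(3)])
  qed
  with has_mat_derivative_mult[OF P N'] have z: "P' ** N s + P s ** N' = 0"
    by (rule has_mat_derivative_unique)
  have NP: "N s ** P s = mat 1" unfolding N_def by (rule cramer_inv_left[OF S(3)[OF S(2)]])
  have "N' = N s ** (P s ** N')" by (metis NP matrix_mul_assoc matrix_mul_lid)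
  also have "P s ** N' = - (P' ** N s)" using z by (simp add: eq_neg_iff_add_eq_0 add.commute)
  finally have N'_eq: "N' = - (N s ** (P' ** N s))" by (simp add: matrix_mult_uminus)
  have "P' ** D = (P' ** N s) ** (P s ** D)"
    by (metis NP matrix_mul_assoc matrix_mul_lid)
  then have "P' ** D ** N s + P s ** D ** N' =
     (P' ** N s) ** (P s ** D ** N s) - (P s ** D ** N s) ** (P' ** N s)"
    by (simp add: N'_eq matrix_mult_uminus matrix_mul_assoc)
  moreover have "has_mat_derivative (\<lambda>s. P s ** D ** N s) (P' ** D ** N s + P s ** D ** N') s"
  proof -
    have "has_mat_derivative (\<lambda>s. P s ** D) (P' ** D) s"
      using has_mat_derivative_mult[OF P has_mat_derivative_const[of D]]
      by (simp add: matrix_mult_zero)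
    from has_mat_derivative_mult[OF this N'] show ?thesis .
  qed
  ultimately have "has_mat_derivative (\<lambda>s. P s ** D ** N s)
    ((P' ** N s) ** (P s ** D ** N s) - (P s ** D ** N s) ** (P' ** N s)) s" by (simp only:)
  then show ?thesis unfolding N_def by (rule exI)
qed

lemma rep_commutator:
  assumes rep: "is_rep \<phi>" and L: "L \<in> sl3"
  shows "B ** L - L ** B \<in> sl3" "\<exists>A. \<phi> (B ** L - L ** B) = A ** \<phi> L - \<phi> L ** A"
proof -
  show sl: "B ** L - L ** B \<in> sl3"
    by (simp add: sl3_def trace_sub trace_mul_sym[of B L])
  define C where "C = B - mat (trace B / 3)"
  have "C \<in> sl3" by (simp add: C_def sl3_def trace_3 mat_def field_simps)
  moreover have "C ** L - L ** C = B ** L - L ** B"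
    unfolding C_def matrix_mult_diff
    by (subst (1 2) mat_eq_mscale) (simp add: mscale_matrix_mult)
  ultimately show "\<exists>A. \<phi> (B ** L - L ** B) = A ** \<phi> L - \<phi> L ** A"
    using rep L unfolding is_rep_def by metis
qed

text \<open>\<open>\<phi>\<close> is controlled only on sl3, so the curve has to stay there on an
  open set around s; on that set the entries of \<open>\<phi> (L s)\<close> are linear in those of L
  s.\<close>

lemma rep_has_mat_derivative:
  assumes rep: "is_rep \<phi>" and S: "open S" "s \<in> S" "\<And>s. s \<in> S \<Longrightarrow> L s \<in> sl3" and L': "L' \<in> sl3"
    and L: "has_mat_derivative L L' s"
  shows "has_mat_derivative (\<lambda>s. \<phi> (L s)) (\<phi> L') s"
  unfolding has_mat_derivative_def
proof (intro allI)
  fix i j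
  have exp: "\<phi> X $ i $ j = (\<Sum>k=1..8. sl3_coords X k * \<phi> (basis_elem k) $ i $ j)" if "X \<in> sl3" for X
    using rep_sl3_elem[OF rep, of "sl3_coords X"] sl3_elem_coords[OF that] by simp
  have co: "((\<lambda>s. sl3_coords (L s) k) has_field_derivative sl3_coords L' k) (at s)" for k
    using L unfolding has_mat_derivative_def sl3_coords_def by (auto intro: DERIV_minus)
  have "((\<lambda>s. \<Sum>k=1..8. sl3_coords (L s) k * \<phi> (basis_elem k) $ i $ j) has_field_derivative \<phi> L' $ i $ j) (at s)"
    unfolding exp[OF L'] by (intro DERIV_sum DERIV_cmult_right co)
  then show "((\<lambda>s. \<phi> (L s) $ i $ j) has_field_derivative \<phi> L' $ i $ j) (at s)"
    by (rule has_field_derivative_transform_within_open[OF _ S(1,2)]) (simp add: exp S(3))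
qed

text \<open>Deform \<open>P\<close> linearly to the identity; this is possible off a finite set of complex parameters,
  whose complement is connected, and the determinant is stationary along the deformation.\<close>

lemma rep_det_conj:
  assumes rep: "is_rep \<phi>" and inv: "invertible P" and D: "D \<in> sl3"
  shows "det (mat z + \<phi> (P ** D ** matrix_inv P)) = det (mat z + \<phi> D)"
proof -
  let ?I = "mat 1 :: complex^3^3"
  define Q where "Q s = ?I + mscale s (P - ?I)" for s
  have Q01: "Q 0 = ?I" "Q 1 = P" by (simp_all add: Q_def mscale_def vec_eq_iff)
  define T where "T = {s. det (Q s) = 0}"
  have "finite T"
  proof -
    have "polyfun (\<lambda>c. det (Q (c 0)))"
      unfolding Q_def
      by (intro polyfun_det_polymat polymat_intros polyfun_const polyfun_var) (auto simp: polymat_def)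
    from polyfun_poly[OF this, of "\<lambda>_. [:0, 1:]"]
    obtain q where q: "\<And>s. det (Q s) = poly q s" by auto
    have "poly q 0 \<noteq> 0" using q[of 0] by (simp add: Q01)
    then have "finite {s. poly q s = 0}" by (intro poly_roots_finite) auto
    then show ?thesis by (simp add: T_def q)
  qed
  define S where "S = UNIV - T"
  have S: "open S" "connected S"
    using \<open>finite T\<close> connected_open_delete_finite[of UNIV T]
    by (auto simp: S_def finite_imp_closed open_Diff)
  define L where "L s = Q s ** D ** cramer_inv (Q s)" for s
  have det_nz: "det (Q s) \<noteq> 0" if "s \<in> S" for s using that by (simp add: S_def T_def)
  have L_eq: "L s = Q s ** D ** matrix_inv (Q s)" if "s \<in> S" for s
    using det_nz[OF that] by (simp add: L_def cramer_inv_eq invertible_det_nz)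
  have Lsl: "L s \<in> sl3" if "s \<in> S" for s
    using D trace_conj[of "Q s" D] det_nz[OF that] unfolding L_eq[OF that]
    by (simp add: sl3_def invertible_det_nz)
  have "(\<lambda>s. det (mat z + \<phi> (L s))) constant_on S"
  proof (rule has_field_derivative_0_imp_constant_on[OF _ S(2,1)])
    fix s assume s: "s \<in> S"
    have "has_mat_derivative Q (P - ?I) s" for s unfolding Q_def by (rule has_mat_derivative_linear)
    from conj_has_derivative[OF this S(1) s det_nz] obtain B where
      B: "has_mat_derivative L (B ** L s - L s ** B) s" unfolding L_def by blast
    obtain A where A: "\<phi> (B ** L s - L s ** B) = A ** \<phi> (L s) - \<phi> (L s) ** A"
      using rep_commutator(2)[OF rep Lsl[OF s]] by blast
    have "has_mat_derivative (\<lambda>s. mat z + \<phi> (L s)) (0 + \<phi> (B ** L s - L s ** B)) s"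
      by (intro has_mat_derivative_add has_mat_derivative_const
          rep_has_mat_derivative[OF rep S(1) s Lsl rep_commutator(1)[OF rep Lsl[OF s]] B])
    from det_has_derivative[OF this]
    have "((\<lambda>s. det (mat z + \<phi> (L s))) has_field_derivative
      det_differential (mat z + \<phi> (L s)) (A ** \<phi> (L s) - \<phi> (L s) ** A)) (at s)"
      by (simp add: A)
    \<comment> \<open>The scalar matrix commutes with A, so the velocity is also a commutator with
      the matrix whose determinant is taken.\<close>
    moreover have "A ** \<phi> (L s) - \<phi> (L s) ** A = A ** (mat z + \<phi> (L s)) - (mat z + \<phi> (L s)) ** A"
    proof -
      have "A ** mat z = mat z ** A" by (subst (1 2) mat_eq_mscale) (simp add: mscale_matrix_mult)
      moreover have "(mat z + \<phi> (L s)) ** A = mat z ** A + \<phi> (L s) ** A"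
        by (simp add: matrix_matrix_mult_def vec_eq_iff ring_distribs sum.distrib)
      ultimately show ?thesis by (simp add: matrix_add_ldistrib)
    qed
    ultimately show "((\<lambda>s. det (mat z + \<phi> (L s))) has_field_derivative 0) (at s)"
      by (simp add: det_differential_commutator)
  qed
  then obtain d where d: "\<And>s. s \<in> S \<Longrightarrow> det (mat z + \<phi> (L s)) = d"
    unfolding constant_on_def by blast
  have in_S: "0 \<in> S" "1 \<in> S" using inv by (simp_all add: S_def T_def Q01 invertible_det_nz)
  have "L 0 = D"
  proof -
    have "invertible ?I" by (simp add: invertible_det_nz)
    then have "matrix_inv ?I = ?I" using matrix_inv_left[of ?I] by simp
    then show ?thesis by (simp add: L_eq[OF in_S(1)] Q01)
  qed
  moreover have "L 1 = P ** D ** matrix_inv P" by (simp add: L_eq[OF in_S(2)] Q01)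
  ultimately show ?thesis using d[OF in_S(1)] d[OF in_S(2)] by simp
qed

section \<open>Weights of an irreducible representation\<close>

text \<open>The adjoint weights of the basis elements. Indices outside 3..8 get weight zero: they
  belong to H1, H2 or to a zero \<open>basis_elem\<close>, so the commutator formulas hold for every
  k.\<close>

definition sl3_root :: "nat \<Rightarrow> weight" where
  "sl3_root k = (if k = 3 then (2, -1) else if k = 4 then (1, 1) else if k = 5 then (-2, 1)
     else if k = 6 then (-1, 2) else if k = 7 then (-1, -1) else if k = 8 then (1, -2) else (0, 0))"

lemma basis_elem_nth:
  "basis_elem k $ 1 $ 1 = (if k = 1 then 1 else 0)"
  "basis_elem k $ 2 $ 2 = (if k = 1 then - 1 else if k = 2 then 1 else 0)"
  "basis_elem k $ 3 $ 3 = (if k = 2 then - 1 else 0)"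
  "basis_elem k $ 1 $ 2 = (if k = 3 then 1 else 0)" "basis_elem k $ 1 $ 3 = (if k = 4 then 1 else 0)"
  "basis_elem k $ 2 $ 1 = (if k = 5 then 1 else 0)" "basis_elem k $ 2 $ 3 = (if k = 6 then 1 else 0)"
  "basis_elem k $ 3 $ 1 = (if k = 7 then 1 else 0)" "basis_elem k $ 3 $ 2 = (if k = 8 then 1 else 0)"
  by (simp_all add: basis_elem_def)

lemma commutator_H_basis:
  "H1 ** basis_elem k - basis_elem k ** H1 = mscale (fst (sl3_root k)) (basis_elem k)"
  "H2 ** basis_elem k - basis_elem k ** H2 = mscale (snd (sl3_root k)) (basis_elem k)"
  by (simp_all add: vec_eq_iff forall_3 matrix_matrix_mult_def sum_3 basis_elem_nth mscale_def sl3_root_def)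

lemma commutator_EF:
  "E12 ** basis_elem 5 - basis_elem 5 ** E12 = H1"
  "E23 ** basis_elem 8 - basis_elem 8 ** E23 = H2"
  by (simp_all add: vec_eq_iff forall_3 matrix_matrix_mult_def sum_3 basis_elem_nth)

lemma mscale_vector_mult: "mscale a M *v v = a *s (M *v v)"
  by (simp add: mscale_def matrix_vector_mult_def vec_eq_iff sum_distrib_left mult.assoc)

lemma rep_bracket:
  assumes "is_rep \<phi>" "X \<in> sl3" "Y \<in> sl3"
  shows "\<phi> X *v (\<phi> Y *v v) = \<phi> (X ** Y - Y ** X) *v v + \<phi> Y *v (\<phi> X *v v)"
  using assms by (simp add: is_rep_def matrix_vector_mult_diff_rdistrib matrix_vector_mul_assoc)

lemma rep_mscale: "is_rep \<phi> \<Longrightarrow> X \<in> sl3 \<Longrightarrow> \<phi> (mscale a X) = mscale a (\<phi> X)"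
  by (simp add: is_rep_def)

lemma weight_space_shift:
  assumes "is_rep \<phi>" "v \<in> weight_space \<phi> \<mu>"
  shows "\<phi> (basis_elem k) *v v \<in> weight_space \<phi> (\<mu> + sl3_root k)"
  using assms
  by (auto simp: weight_space_def rep_bracket[OF assms(1) basis_elem_in_sl3 basis_elem_in_sl3] commutator_H_basis
      rep_mscale mscale_vector_mult vector_scalar_commute vec.scale_left_distrib add.commute
      simp del: One_nat_def)

lemma subspace_weight_space: "vec.subspace (weight_space \<phi> \<mu>)"
  by (auto simp: vec.subspace_def weight_space_def matrix_vector_right_distrib vec.scale_right_distrib
      vector_scalar_commute vec.scale_left_commute)

lemma zero_in_weight_space [simp]: "0 \<in> weight_space \<phi> \<mu>"
  by (simp add: weight_space_def)

lemma weight_vectors_sum_zero: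
  assumes "finite J" "\<And>\<mu>. \<mu> \<in> J \<Longrightarrow> w \<mu> \<in> weight_space \<phi> \<mu>" "(\<Sum>\<mu>\<in>J. w \<mu>) = 0" "\<mu> \<in> J"
  shows "w \<mu> = 0"
proof (rule joint_eigenvectors_sum_zero[where J = J and w = w and A = "\<lambda>b. if b then \<phi> H1 else \<phi> H2"
      and l = "\<lambda>b \<mu>. if b then fst \<mu> else snd \<mu>"])
  show "(if b then \<phi> H1 else \<phi> H2) *v w i = (if b then fst i else snd i) *s w i" if "i \<in> J" for i b
    using assms(2)[OF that] by (simp add: weight_space_def)
  show "\<exists>b. (if b then fst i else snd i) \<noteq> (if b then fst j else snd j)" if "i \<noteq> j" for i j :: weight
    using that by (cases "fst i = fst j") (auto simp: prod_eq_iff intro: exI[of _ True] exI[of _ False])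
qed (use assms in auto)

lemma weight_spaces_disjoint:
  assumes "v \<in> weight_space \<phi> \<mu>" "v \<in> weight_space \<phi> \<nu>" "v \<noteq> 0"
  shows "\<mu> = \<nu>"
  using assms by (auto simp: weight_space_def prod_eq_iff)

lemma independent_union_weight_spaces:
  assumes "finite J" "\<And>\<mu>. \<mu> \<in> J \<Longrightarrow> B \<mu> \<subseteq> weight_space \<phi> \<mu>" "\<And>\<mu>. \<mu> \<in> J \<Longrightarrow> vec.independent (B \<mu>)"
  shows "vec.independent (\<Union>\<mu>\<in>J. B \<mu>)" "\<forall>\<mu>\<in>J. \<forall>\<nu>\<in>J. \<mu> \<noteq> \<nu> \<longrightarrow> B \<mu> \<inter> B \<nu> = {}"
proof -
  have fin: "finite (B \<mu>)" if "\<mu> \<in> J" for \<mu> using assms(3)[OF that] by (rule vec.finiteI_independent)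
  show disj: "\<forall>\<mu>\<in>J. \<forall>\<nu>\<in>J. \<mu> \<noteq> \<nu> \<longrightarrow> B \<mu> \<inter> B \<nu> = {}"
  proof (intro ballI impI equals0I)
    fix \<mu> \<nu> v assume *: "\<mu> \<in> J" "\<nu> \<in> J" "\<mu> \<noteq> \<nu>" "v \<in> B \<mu> \<inter> B \<nu>"
    then have "v \<noteq> 0" using assms(3)[of \<mu>] vec.dependent_zero by blast
    then show False using weight_spaces_disjoint[of v \<phi> \<mu> \<nu>] assms(2) * by blast
  qed
  show "vec.independent (\<Union>\<mu>\<in>J. B \<mu>)"
  proof (rule vec.independent_if_scalars_zero)
    show "finite (\<Union>\<mu>\<in>J. B \<mu>)" using assms(1) fin by blast
    fix u x assume sum: "(\<Sum>x\<in>(\<Union>\<mu>\<in>J. B \<mu>). u x *s x) = 0" and "x \<in> (\<Union>\<mu>\<in>J. B \<mu>)"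
    then obtain \<mu> where \<mu>: "\<mu> \<in> J" "x \<in> B \<mu>" by blast
    define w where "w \<mu> = (\<Sum>x\<in>B \<mu>. u x *s x)" for \<mu>
    have "(\<Sum>\<mu>\<in>J. w \<mu>) = 0"
      using sum disj assms(1) fin unfolding w_def by (subst (asm) sum.UNION_disjoint) auto
    moreover have "w \<nu> \<in> weight_space \<phi> \<nu>" if "\<nu> \<in> J" for \<nu>
      unfolding w_def using assms(2)[OF that]
      by (intro vec.subspace_sum vec.subspace_scale subspace_weight_space) auto
    ultimately have "w \<mu> = 0" using weight_vectors_sum_zero[OF assms(1) _ _ \<mu>(1)] by blast
    then show "u x = 0"
      using vec.independentD[OF assms(3)[OF \<mu>(1)] fin[OF \<mu>(1)] subset_refl _ \<mu>(2)] unfolding w_def by blast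
  qed
qed

text \<open>One nonzero vector for each of several weights forms an independent set, so the
  dimension bounds the number of weights.\<close>

lemma finite_weights:
  fixes \<phi> :: "complex^3^3 \<Rightarrow> complex^'n^'n"
  shows "finite (weights \<phi>)"
proof (rule ccontr)
  assume "infinite (weights \<phi>)"
  then obtain J where J: "J \<subseteq> weights \<phi>" "finite J" "card J = Suc CARD('n)"
    using infinite_arbitrarily_large by blast
  have "\<exists>v. v \<in> weight_space \<phi> \<mu> \<and> v \<noteq> 0" if "\<mu> \<in> J" for \<mu>
    using that J(1) zero_in_weight_space[of \<phi> \<mu>] unfolding weights_def by blast
  then obtain v where v: "\<And>\<mu>. \<mu> \<in> J \<Longrightarrow> v \<mu> \<in> weight_space \<phi> \<mu>" "\<And>\<mu>. \<mu> \<in> J \<Longrightarrow> v \<mu> \<noteq> 0" by metis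
  have "vec.independent (\<Union>\<mu>\<in>J. {v \<mu>})"
    using v by (intro independent_union_weight_spaces[OF J(2)]) auto
  moreover have "(\<Union>\<mu>\<in>J. {v \<mu>}) = v ` J" by auto
  moreover have "inj_on v J" using v weight_spaces_disjoint by (metis inj_onI)
  ultimately have "card J \<le> vec.dim (UNIV :: (complex^'n) set)"
    using vec.independent_card_le_dim[of "v ` J" UNIV] by (simp add: card_image)
  then show False using J(3) unfolding vec_dim_card by simp
qed

text \<open>The lowering string of a highest weight vector must terminate, which forces the weight to
  be a natural number.\<close>

lemma sl2_highest_weight_nat:
  assumes rep: "is_rep \<phi>" and E: "E \<in> sl3" and H: "H \<in> sl3"
    and EF: "E ** basis_elem k - basis_elem k ** E = H"
    and HF: "H ** basis_elem k - basis_elem k ** H = mscale (- 2) (basis_elem k)"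
    and v: "v \<in> weight_space \<phi> \<mu>" "v \<noteq> 0" "\<phi> H *v v = a *s v" "\<phi> E *v v = 0"
    and nz: "sl3_root k \<noteq> 0"
  shows "a \<in> \<nat>"
proof -
  define f where "f n = (((*v) (\<phi> (basis_elem k))) ^^ n) v" for n
  have f_Suc: "f (Suc n) = \<phi> (basis_elem k) *v f n" and f0: "f 0 = v" for n by (simp_all add: f_def)
  have Hf: "\<phi> H *v f n = (a - 2 * of_nat n) *s f n" for n
  proof (induction n)
    case (Suc n)
    have "\<phi> H *v f (Suc n) = - 2 *s f (Suc n) + \<phi> (basis_elem k) *v (\<phi> H *v f n)"
      unfolding f_Suc rep_bracket[OF rep H basis_elem_in_sl3] HF
      by (simp add: rep_mscale[OF rep] mscale_vector_mult)
    also have "\<dots> = (a - 2 * of_nat (Suc n)) *s f (Suc n)"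
      unfolding Suc f_Suc vector_scalar_commute vec.scale_left_distrib[symmetric] by (simp add: algebra_simps)
    finally show ?case .
  qed (simp add: f0 v)
  have Ef: "\<phi> E *v f (Suc n) = (of_nat (Suc n) * (a - of_nat n)) *s f n" for n
  proof (induction n)
    case 0
    have "\<phi> E *v f (Suc 0) = \<phi> H *v f 0 + \<phi> (basis_elem k) *v (\<phi> E *v f 0)"
      unfolding f_Suc rep_bracket[OF rep E basis_elem_in_sl3] EF ..
    then show ?case by (simp add: f0 v)
  next
    case (Suc n)
    have "\<phi> E *v f (Suc (Suc n)) = \<phi> H *v f (Suc n) + \<phi> (basis_elem k) *v (\<phi> E *v f (Suc n))"
      by (subst f_Suc) (simp only: rep_bracket[OF rep E basis_elem_in_sl3] EF)
    also have "\<dots> = ((a - 2 * of_nat (Suc n)) + of_nat (Suc n) * (a - of_nat n)) *s f (Suc n)"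
      unfolding Hf Suc vector_scalar_commute vec.scale_left_distrib f_Suc[symmetric] ..
    also have "(a - 2 * of_nat (Suc n)) + of_nat (Suc n) * (a - of_nat n)
        = of_nat (Suc (Suc n)) * (a - of_nat (Suc n))"
      by (simp add: algebra_simps)
    finally show ?case .
  qed
  \<comment> \<open>The weights along the string are pairwise distinct, so a string that never
    vanishes would produce infinitely many weights.\<close>
  define \<nu> where "\<nu> n = (fst \<mu> + of_nat n * fst (sl3_root k), snd \<mu> + of_nat n * snd (sl3_root k))" for n
  have f_wt: "f n \<in> weight_space \<phi> (\<nu> n)" for n
  proof (induction n)
    case (Suc n)
    have "\<nu> (Suc n) = \<nu> n + sl3_root k" by (simp add: \<nu>_def prod_eq_iff algebra_simps)
    then show ?case using weight_space_shift[OF rep Suc, of k] by (simp add: f_Suc)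
  qed (simp add: \<nu>_def f0 v)
  have "\<exists>n. f n = 0"
  proof (rule ccontr)
    assume "\<nexists>n. f n = 0"
    then have "\<nu> n \<in> weights \<phi>" for n using f_wt[of n] unfolding weights_def by blast
    then have "finite (range \<nu>)" using finite_weights[of \<phi>] by (meson finite_subset image_subsetI)
    moreover have "inj \<nu>" using nz by (auto simp: inj_def \<nu>_def prod_eq_iff)
    ultimately show False using finite_imageD infinite_UNIV_nat by blast
  qed
  then have Least: "f (LEAST n. f n = 0) = 0" by (rule LeastI_ex)
  moreover have "f 0 \<noteq> 0" using v f0 by simp
  \<comment> \<open>f n is the last nonzero vector of the string; E sends f (Suc n) = 0 to (n + 1)
    (a - n) f n, which forces a = n.\<close>
  ultimately obtain n where n: "(LEAST n. f n = 0) = Suc n" by (metis not0_implies_Suc)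
  then have "f n \<noteq> 0" using not_less_Least[of n "\<lambda>n. f n = 0"] by simp
  moreover have "(of_nat (Suc n) * (a - of_nat n)) *s f n = 0"
    using Ef[of n] Least n by simp
  ultimately have "a = of_nat n" using of_nat_neq_0[of n, where 'a = complex] by (auto simp del: of_nat_Suc)
  then show ?thesis by simp
qed

lemma highest_weight_nat:
  assumes "is_rep \<phi>" "has_highest_weight \<phi> hw"
  shows "fst hw \<in> \<nat>" "snd hw \<in> \<nat>"
proof -
  obtain v where v: "v \<noteq> 0" "v \<in> weight_space \<phi> hw" "\<phi> E12 *v v = 0" "\<phi> E23 *v v = 0"
    using assms(2) unfolding has_highest_weight_def by blast
  \<comment> \<open>Indices 5 and 8 are E21 and E32, the lowering partners of E12 and E23.\<close>
  have "H1 ** basis_elem 5 - basis_elem 5 ** H1 = mscale (- 2) (basis_elem 5)"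
    "H2 ** basis_elem 8 - basis_elem 8 ** H2 = mscale (- 2) (basis_elem 8)"
    using commutator_H_basis(1)[of 5] commutator_H_basis(2)[of 8] by (simp_all add: sl3_root_def)
  moreover have "\<phi> H1 *v v = fst hw *s v" "\<phi> H2 *v v = snd hw *s v"
    using v(2) by (simp_all add: weight_space_def)
  moreover have "sl3_root 5 \<noteq> 0" "sl3_root 8 \<noteq> 0" by (simp_all add: sl3_root_def zero_prod_def)
  ultimately show "fst hw \<in> \<nat>" "snd hw \<in> \<nat>"
    using sl2_highest_weight_nat[OF assms(1) basis_elem_in_sl3 basis_elem_in_sl3 commutator_EF(1) _ v(2,1) _ v(3)]
      sl2_highest_weight_nat[OF assms(1) basis_elem_in_sl3 basis_elem_in_sl3 commutator_EF(2) _ v(2,1) _ v(4)]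
    by blast+
qed

section \<open>Weight bases and the determinant on the Cartan subalgebra\<close>

definition integral_weights :: "weight set" where
  "integral_weights = {\<mu>. fst \<mu> \<in> \<int> \<and> snd \<mu> \<in> \<int>}"

text \<open>Root shifts preserve integrality, so the span is invariant; it contains the highest
  weight vector, so irreducibility makes it the whole space. This yields simultaneous
  diagonalizability of H1 and H2.\<close>

lemma integral_weight_spaces_span:
  assumes irr: "is_irreducible_rep \<phi>" and hw: "has_highest_weight \<phi> hw"
  shows "vec.span (\<Union>\<mu>\<in>integral_weights. weight_space \<phi> \<mu>) = UNIV"
proof -
  let ?W = "vec.span (\<Union>\<mu>\<in>integral_weights. weight_space \<phi> \<mu>)"
  have rep: "is_rep \<phi>" using irr unfolding is_irreducible_rep_def by blast
  have basis: "\<phi> (basis_elem k) *v w \<in> ?W" if "w \<in> ?W" for w k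
    using that
  proof (induction rule: vec.span_induct_alt)
    case base
    then show ?case by (simp add: vec.span_zero)
  next
    case (step c x y)
    then obtain \<mu> where \<mu>: "\<mu> \<in> integral_weights" "x \<in> weight_space \<phi> \<mu>" by blast
    have "\<mu> + sl3_root k \<in> integral_weights"
      using \<mu>(1) by (auto simp: integral_weights_def sl3_root_def)
    then have "\<phi> (basis_elem k) *v x \<in> ?W"
      using weight_space_shift[OF rep \<mu>(2), of k] by (blast intro: vec.span_base)
    then show ?case
      using step by (simp add: matrix_vector_right_distrib vector_scalar_commute vec.span_add vec.span_scale)
  qed
  have "\<phi> X *v w \<in> ?W" if "X \<in> sl3" "w \<in> ?W" for X w
  proof -
    have "\<phi> X $ i $ j = (\<Sum>k=1..8. sl3_coords X k * \<phi> (basis_elem k) $ i $ j)" for i j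
      using rep_sl3_elem[OF rep, of "sl3_coords X"] sl3_elem_coords[OF that(1)] by simp
    then have "\<phi> X *v w = (\<Sum>k=1..8. sl3_coords X k *s (\<phi> (basis_elem k) *v w))"
      by (simp add: vec_eq_iff matrix_vector_mult_def sum_distrib_left sum_distrib_right mult.assoc
          sum.swap[of _ "UNIV"])
    also have "\<dots> \<in> ?W" by (intro vec.span_sum vec.span_scale basis that(2))
    finally show ?thesis .
  qed
  then have "?W = {0} \<or> ?W = UNIV"
    using irr unfolding is_irreducible_rep_def by (blast intro: vec.subspace_span)
  moreover obtain v where "v \<noteq> 0" "v \<in> weight_space \<phi> hw"
    using hw unfolding has_highest_weight_def by blast
  moreover have "hw \<in> integral_weights"
    using highest_weight_nat[OF rep hw] Nats_subset_Ints by (auto simp: integral_weights_def)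
  ultimately show ?thesis using vec.span_base[of v "\<Union>\<mu>\<in>integral_weights. weight_space \<phi> \<mu>"] by blast
qed

lemma weight_basis_exists:
  assumes irr: "is_irreducible_rep \<phi>" and hw: "has_highest_weight \<phi> hw"
  shows "weights \<phi> \<subseteq> integral_weights"
    and "\<exists>B. (\<forall>\<mu>\<in>weights \<phi>. B \<mu> \<subseteq> weight_space \<phi> \<mu> \<and> vec.independent (B \<mu>) \<and> card (B \<mu>) = weight_mult \<phi> \<mu>)
      \<and> vec.span (\<Union>\<mu>\<in>weights \<phi>. B \<mu>) = UNIV"
proof -
  have "\<exists>B. B \<subseteq> weight_space \<phi> \<mu> \<and> vec.independent B \<and> weight_space \<phi> \<mu> \<subseteq> vec.span B \<and> card B = weight_mult \<phi> \<mu>" for \<mu>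
  proof -
    obtain B where "B \<subseteq> weight_space \<phi> \<mu>" "vec.independent B" "weight_space \<phi> \<mu> \<subseteq> vec.span B"
      "card B = vec.dim (weight_space \<phi> \<mu>)" by (rule vec.basis_exists)
    then show ?thesis unfolding weight_mult_def by (intro exI[of _ B]) simp
  qed
  then have "\<exists>B. \<forall>\<mu>. B \<mu> \<subseteq> weight_space \<phi> \<mu> \<and> vec.independent (B \<mu>) \<and> weight_space \<phi> \<mu> \<subseteq> vec.span (B \<mu>)
    \<and> card (B \<mu>) = weight_mult \<phi> \<mu>" by (intro choice allI)
  then obtain B where B: "\<And>\<mu>. B \<mu> \<subseteq> weight_space \<phi> \<mu>" "\<And>\<mu>. vec.independent (B \<mu>)"
    "\<And>\<mu>. weight_space \<phi> \<mu> \<subseteq> vec.span (B \<mu>)" "\<And>\<mu>. card (B \<mu>) = weight_mult \<phi> \<mu>" by blast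
  \<comment> \<open>Only integral weights are collected at first; that there are no others is
    deduced after their bases are known to span.\<close>
  define J where "J = weights \<phi> \<inter> integral_weights"
  have finJ: "finite J" unfolding J_def using finite_weights by blast
  have "(\<Union>\<mu>\<in>integral_weights. weight_space \<phi> \<mu>) \<subseteq> vec.span (\<Union>\<mu>\<in>J. B \<mu>)"
  proof
    fix v assume "v \<in> (\<Union>\<mu>\<in>integral_weights. weight_space \<phi> \<mu>)"
    then obtain \<mu> where \<mu>: "\<mu> \<in> integral_weights" "v \<in> weight_space \<phi> \<mu>" by blast
    show "v \<in> vec.span (\<Union>\<mu>\<in>J. B \<mu>)"
    proof (cases "\<mu> \<in> weights \<phi>")
      case True
      then have "vec.span (B \<mu>) \<subseteq> vec.span (\<Union>\<mu>\<in>J. B \<mu>)"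
        using \<mu>(1) unfolding J_def by (intro vec.span_mono) blast
      then show ?thesis using B(3) \<mu>(2) by blast
    next
      case False
      then have "v = 0" using \<mu>(2) unfolding weights_def by blast
      then show ?thesis by (simp add: vec.span_zero)
    qed
  qed
  then have "vec.span (\<Union>\<mu>\<in>integral_weights. weight_space \<phi> \<mu>) \<subseteq> vec.span (\<Union>\<mu>\<in>J. B \<mu>)"
    by (intro vec.span_minimal vec.subspace_span)
  then have span: "vec.span (\<Union>\<mu>\<in>J. B \<mu>) = UNIV"
    using integral_weight_spaces_span[OF irr hw] by blast
  have "weights \<phi> = J"
  proof (rule ccontr)
    assume "weights \<phi> \<noteq> J"
    then obtain \<kappa> where \<kappa>: "\<kappa> \<in> weights \<phi>" "\<kappa> \<notin> J" unfolding J_def by blast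
    then obtain u where u: "u \<in> weight_space \<phi> \<kappa>" "u \<noteq> 0"
      using zero_in_weight_space[of \<phi> \<kappa>] unfolding weights_def by blast
    \<comment> \<open>A vector of one further weight would be independent of bases that already
      span.\<close>
    let ?B = "B(\<kappa> := {u})"
    have "vec.independent (\<Union>\<mu>\<in>insert \<kappa> J. ?B \<mu>)"
      using B u finJ by (intro independent_union_weight_spaces[where \<phi> = \<phi>]) auto
    moreover have "(\<Union>\<mu>\<in>insert \<kappa> J. ?B \<mu>) = insert u (\<Union>\<mu>\<in>J. B \<mu>)"
      using \<kappa>(2) by auto
    moreover have "u \<notin> (\<Union>\<mu>\<in>J. B \<mu>)"
      using weight_spaces_disjoint[OF u(1) _ u(2)] B(1) \<kappa>(2) by blast
    ultimately have "u \<notin> vec.span (\<Union>\<mu>\<in>J. B \<mu>)"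
      by (simp only: vec.independent_insert if_False simp_thms)
    then show False using span by simp
  qed
  then show "weights \<phi> \<subseteq> integral_weights" unfolding J_def by blast
  show "\<exists>B. (\<forall>\<mu>\<in>weights \<phi>. B \<mu> \<subseteq> weight_space \<phi> \<mu> \<and> vec.independent (B \<mu>) \<and> card (B \<mu>) = weight_mult \<phi> \<mu>)
      \<and> vec.span (\<Union>\<mu>\<in>weights \<phi>. B \<mu>) = UNIV"
    using B span \<open>weights \<phi> = J\<close> by (intro exI[of _ B]) simp
qed

lemma rep_diag_weight_vector:
  assumes rep: "is_rep \<phi>" and sum: "\<theta>$1 + \<theta>$2 + \<theta>$3 = 0" and v: "v \<in> weight_space \<phi> \<mu>"
  shows "\<phi> (diag_mat \<theta>) *v v = wt_at \<mu> \<theta> *s v"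
proof -
  have th3: "\<theta>$3 = - \<theta>$1 - \<theta>$2"
    using sum by (simp add: eq_neg_iff_add_eq_0 algebra_simps)
  have "diag_mat \<theta> = mscale (\<theta>$1) H1 + mscale (\<theta>$1 + \<theta>$2) H2"
    by (simp add: vec_eq_iff forall_3 diag_mat_nth mscale_def basis_elem_nth th3)
  moreover have "mscale a (basis_elem k) \<in> sl3" for a k
    unfolding basis_elem_def sl3_elem_mscale[symmetric] by simp
  ultimately have "\<phi> (diag_mat \<theta>) = mscale (\<theta>$1) (\<phi> H1) + mscale (\<theta>$1 + \<theta>$2) (\<phi> H2)"
    using rep rep_mscale[OF rep basis_elem_in_sl3] unfolding is_rep_def by simp
  then show ?thesis
    using v by (simp add: weight_space_def matrix_vector_mult_add_rdistrib mscale_vector_mult wt_at_def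
        vec.scale_left_distrib algebra_simps)
qed

lemma det_rep_diag:
  fixes \<phi> :: "complex^3^3 \<Rightarrow> complex^'n^'n"
  assumes irr: "is_irreducible_rep \<phi>" and hw: "has_highest_weight \<phi> hw" and sum: "\<theta>$1 + \<theta>$2 + \<theta>$3 = 0"
  shows "det (mat z + \<phi> (diag_mat \<theta>)) = (\<Prod>\<mu>\<in>weights \<phi>. (z + wt_at \<mu> \<theta>) ^ weight_mult \<phi> \<mu>)"
proof -
  have rep: "is_rep \<phi>" using irr unfolding is_irreducible_rep_def by blast
  obtain B where B: "\<And>\<mu>. \<mu> \<in> weights \<phi> \<Longrightarrow> B \<mu> \<subseteq> weight_space \<phi> \<mu>"
    "\<And>\<mu>. \<mu> \<in> weights \<phi> \<Longrightarrow> vec.independent (B \<mu>)"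
    "\<And>\<mu>. \<mu> \<in> weights \<phi> \<Longrightarrow> card (B \<mu>) = weight_mult \<phi> \<mu>"
    and span: "vec.span (\<Union>\<mu>\<in>weights \<phi>. B \<mu>) = UNIV"
    using weight_basis_exists(2)[OF irr hw] by blast
  define BB where "BB = (\<Union>\<mu>\<in>weights \<phi>. B \<mu>)"
  have ind: "vec.independent BB" and disj: "\<forall>\<mu>\<in>weights \<phi>. \<forall>\<nu>\<in>weights \<phi>. \<mu> \<noteq> \<nu> \<longrightarrow> B \<mu> \<inter> B \<nu> = {}"
    unfolding BB_def using independent_union_weight_spaces[OF finite_weights B(1,2)] by blast+
  have finB: "finite (B \<mu>)" if "\<mu> \<in> weights \<phi>" for \<mu> using B(2)[OF that] by (rule vec.finiteI_independent)
  have "card BB = CARD('n)"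
    using vec.dim_span_eq_card_independent[OF ind] unfolding BB_def span vec_dim_card by simp
  then obtain \<beta> where \<beta>: "bij_betw \<beta> (UNIV :: 'n set) BB"
    using finite_same_card_bij[of "UNIV :: 'n set" BB] vec.finiteI_independent[OF ind] by auto
  define Q :: "complex^'n^'n" where "Q = (\<chi> i j. \<beta> j $ i)"
  have col: "column j Q = \<beta> j" for j by (simp add: column_def Q_def vec_eq_iff)
  have "columns Q = BB" using \<beta> by (auto simp: columns_def col bij_betw_def)
  then have "invertible Q"
    unfolding invertible_right_inverse matrix_right_invertible_span_columns using span by (simp add: BB_def)
  then have detQ: "det Q \<noteq> 0" by (simp add: invertible_det_nz)
  \<comment> \<open>Recovers the weight of a basis vector, which is unique because the chosen bases
    are disjoint; the eigenvalue alone could be shared by several weights.\<close>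
  define wf where "wf b = (THE \<mu>. \<mu> \<in> weights \<phi> \<and> b \<in> B \<mu>)" for b
  have wf: "wf b = \<mu>" if "\<mu> \<in> weights \<phi>" "b \<in> B \<mu>" for b \<mu>
    unfolding wf_def using that disj by (intro the_equality) auto
  define g where "g b = z + wt_at (wf b) \<theta>" for b
  define \<Lambda> :: "complex^'n^'n" where "\<Lambda> = (\<chi> i j. if i = j then g (\<beta> j) else 0)"
  have "(mat z + \<phi> (diag_mat \<theta>)) ** Q = Q ** \<Lambda>"
  proof -
    have "((mat z + \<phi> (diag_mat \<theta>)) ** Q) $ i $ j = (Q ** \<Lambda>) $ i $ j" for i j
    proof -
      have "\<beta> j \<in> BB" using \<beta> by (auto simp: bij_betw_def)
      then obtain \<mu> where \<mu>: "\<mu> \<in> weights \<phi>" "\<beta> j \<in> B \<mu>" unfolding BB_def by blast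
      have "\<phi> (diag_mat \<theta>) *v \<beta> j = wt_at \<mu> \<theta> *s \<beta> j"
        using rep_diag_weight_vector[OF rep sum] B(1)[OF \<mu>(1)] \<mu>(2) by blast
      moreover have "mat z *v \<beta> j = z *s \<beta> j"
        by (simp add: mat_eq_mscale[of z] mscale_vector_mult)
      ultimately have e: "(mat z + \<phi> (diag_mat \<theta>)) *v \<beta> j = g (\<beta> j) *s \<beta> j"
        by (simp add: matrix_vector_mult_add_rdistrib g_def wf[OF \<mu>] vec.scale_left_distrib)
      have "((mat z + \<phi> (diag_mat \<theta>)) ** Q) $ i $ j = ((mat z + \<phi> (diag_mat \<theta>)) *v \<beta> j) $ i"
        by (simp add: matrix_matrix_mult_def matrix_vector_mult_def Q_def)
      also have "\<dots> = (Q ** \<Lambda>) $ i $ j"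
        by (simp add: e matrix_matrix_mult_def Q_def \<Lambda>_def if_distrib if_distribR sum.delta mult.commute cong: if_cong)
      finally show ?thesis .
    qed
    then show ?thesis by (simp add: vec_eq_iff)
  qed
  then have "det (mat z + \<phi> (diag_mat \<theta>)) * det Q = det Q * det \<Lambda>" by (simp flip: det_mul)
  then have "det (mat z + \<phi> (diag_mat \<theta>)) = det \<Lambda>" using detQ by simp
  also have "\<dots> = (\<Prod>j\<in>UNIV. g (\<beta> j))" by (subst det_diagonal) (simp_all add: \<Lambda>_def)
  also have "\<dots> = (\<Prod>b\<in>BB. g b)" using \<beta> by (rule prod.reindex_bij_betw)
  also have "\<dots> = (\<Prod>\<mu>\<in>weights \<phi>. \<Prod>b\<in>B \<mu>. g b)"
    unfolding BB_def using finB disj by (intro prod.UNION_disjoint finite_weights) auto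
  also have "\<dots> = (\<Prod>\<mu>\<in>weights \<phi>. (z + wt_at \<mu> \<theta>) ^ weight_mult \<phi> \<mu>)"
    by (intro prod.cong refl) (simp add: g_def wf B(3))
  finally show ?thesis .
qed

lemma diag_mat_in_sl3: "\<theta>$1 + \<theta>$2 + \<theta>$3 = 0 \<Longrightarrow> diag_mat \<theta> \<in> sl3"
  by (simp add: sl3_def trace_3 diag_mat_nth)

lemma det_rep_diag_permute:
  assumes rep: "is_rep \<phi>" and sum: "\<theta>$1 + \<theta>$2 + \<theta>$3 = 0" and \<sigma>: "\<sigma> permutes (UNIV :: 3 set)"
  shows "det (mat z + \<phi> (diag_mat (\<chi> i. \<theta> $ \<sigma> i))) = det (mat z + \<phi> (diag_mat \<theta>))"
proof -
  define P :: "complex^3^3" where "P = (\<chi> i j. if j = \<sigma> i then 1 else 0)"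
  have inj: "\<sigma> i = \<sigma> j \<longleftrightarrow> i = j" for i j using permutes_inj[OF \<sigma>] by (auto dest: injD)
  have "P ** transpose P = mat 1"
  proof -
    have "(\<Sum>k\<in>UNIV. (if k = \<sigma> i then 1 else 0) * (if k = \<sigma> j then 1 else 0)) = (if i = j then 1 else 0 :: complex)" for i j
      by (cases "i = j") (auto simp: inj if_distrib if_distribR cong: if_cong)
    then show ?thesis
      by (simp add: vec_eq_iff P_def transpose_def matrix_matrix_mult_def mat_def)
  qed
  then have inv: "invertible P" unfolding invertible_right_inverse by blast
  have "P ** diag_mat \<theta> = diag_mat (\<chi> i. \<theta> $ \<sigma> i) ** P"
  proof -
    have "(\<Sum>k\<in>UNIV. (if k = \<sigma> i then 1 else 0) * (if k = j then \<theta> $ k else 0))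
      = (\<Sum>k\<in>UNIV. (if i = k then \<theta> $ \<sigma> i else 0) * (if j = \<sigma> k then 1 else 0))" for i j
      unfolding mult_delta_left by simp
    then show ?thesis
      by (simp add: vec_eq_iff P_def matrix_matrix_mult_def diag_mat_nth cong: if_cong)
  qed
  then have "P ** diag_mat \<theta> ** matrix_inv P = diag_mat (\<chi> i. \<theta> $ \<sigma> i) ** (P ** matrix_inv P)"
    by (simp add: matrix_mul_assoc)
  then have "diag_mat (\<chi> i. \<theta> $ \<sigma> i) = P ** diag_mat \<theta> ** matrix_inv P"
    by (simp add: matrix_inv_right[OF inv])
  then show ?thesis using rep_det_conj[OF rep inv diag_mat_in_sl3[OF sum]] by simp
qed

section \<open>Weyl invariance of the multiplicities\<close>

lemma order_prod_linear_powers: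
  fixes r :: "'b \<Rightarrow> complex"
  assumes "finite A"
  shows "order (- s) (\<Prod>x\<in>A. [:r x, 1:] ^ m x) = (\<Sum>x\<in>A. if r x = s then m x else 0)"
  using assms
proof (induction A rule: finite_induct)
  case (insert x A)
  have nz: "(\<Prod>x\<in>A. [:r x, 1:] ^ m x) \<noteq> 0" for A using prod_zero_iff[of A] by (cases "finite A") auto
  have "order (- s) ([:r x, 1:] ^ m x) = (if r x = s then m x else 0)"
  proof (cases "r x = s")
    case True
    then show ?thesis using order_power_n_n[of "- s" "m x"] by simp
  next
    case False
    then show ?thesis by (auto simp: poly_power intro!: order_0I)
  qed
  moreover have "order (- s) ([:r x, 1:] ^ m x * (\<Prod>x\<in>A. [:r x, 1:] ^ m x)) =
    order (- s) ([:r x, 1:] ^ m x) + order (- s) (\<Prod>x\<in>A. [:r x, 1:] ^ m x)"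
    by (rule order_mult) (use nz[of A] in simp)
  ultimately show ?case using insert by simp
qed (simp add: order_0I)

lemma weyl_act_inj:
  assumes "\<sigma> permutes UNIV" "weyl_act \<sigma> \<mu> = weyl_act \<sigma> \<nu>"
  shows "\<mu> = \<nu>"
  using permutes_3_cases[OF assms(1)] assms(2)
  by (cases \<mu>; cases \<nu>) (auto simp: weyl_act_eq)

lemma integral_weights_real: "\<mu> \<in> integral_weights \<Longrightarrow> fst \<mu> \<in> \<real> \<and> snd \<mu> \<in> \<real>"
  by (auto simp: integral_weights_def elim!: Ints_cases)

lemma integral_weights_weyl_act:
  assumes "\<sigma> permutes UNIV" "\<mu> \<in> integral_weights"
  shows "weyl_act \<sigma> \<mu> \<in> integral_weights"
  using permutes_3_cases[OF assms(1)] assms(2)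
  by (cases \<mu>) (auto simp: weyl_act_eq integral_weights_def)

lemma weight_mult_eq_0_iff:
  "weight_mult \<phi> \<mu> = 0 \<longleftrightarrow> \<mu> \<notin> weights \<phi>"
  using zero_in_weight_space[of \<phi> \<mu>] unfolding weight_mult_def weights_def
  by (auto simp: vec.dim_eq_0)

lemma weight_mult_weyl_act:
  assumes irr: "is_irreducible_rep \<phi>" and hw: "has_highest_weight \<phi> hw"
    and \<sigma>: "\<sigma> permutes UNIV" and \<mu>: "\<mu> \<in> weights \<phi>"
  shows "weight_mult \<phi> (weyl_act \<sigma> \<mu>) = weight_mult \<phi> \<mu>"
proof -
  have rep: "is_rep \<phi>" using irr unfolding is_irreducible_rep_def by blast
  have int: "\<nu> \<in> integral_weights" if "\<nu> \<in> weights \<phi>" for \<nu>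
    using weight_basis_exists(1)[OF irr hw] that by blast
  have sum': "(\<chi> i. theta0 $ \<sigma> i) $ 1 + (\<chi> i. theta0 $ \<sigma> i) $ 2 + (\<chi> i. theta0 $ \<sigma> i) $ 3 = 0"
    using permutes_3_cases[OF \<sigma>] theta0(1) by (auto simp: add_ac)
  let ?p = "\<Prod>\<nu>\<in>weights \<phi>. [:wt_at \<nu> theta0, 1:] ^ weight_mult \<phi> \<nu>"
  let ?q = "\<Prod>\<nu>\<in>weights \<phi>. [:wt_at (weyl_act \<sigma> \<nu>) theta0, 1:] ^ weight_mult \<phi> \<nu>"
  have "poly ?p z = poly ?q z" for z
    using det_rep_diag_permute[OF rep theta0(1) \<sigma>, of z]
    by (simp add: det_rep_diag[OF irr hw theta0(1)] det_rep_diag[OF irr hw sum'] poly_prod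
        wt_at_weyl_act[OF \<sigma> theta0(1)] add.commute)
  then have "?p = ?q" by (simp add: poly_eq_poly_eq_iff[symmetric] fun_eq_iff)
  \<comment> \<open>As \<open>theta0\<close> separates integral weights, the order of the root
    \<open>- ?s\<close> counts a single weight: \<open>weyl_act \<sigma> \<mu>\<close> in
    \<open>?p\<close> and \<open>\<mu>\<close> in \<open>?q\<close>.\<close>
  let ?s = "wt_at (weyl_act \<sigma> \<mu>) theta0"
  have eq: "wt_at \<nu> theta0 = wt_at \<nu>' theta0 \<longleftrightarrow> \<nu> = \<nu>'" if "\<nu> \<in> integral_weights" "\<nu>' \<in> integral_weights" for \<nu> \<nu>'
    using wt_at_theta0_inj[of \<nu> \<nu>'] integral_weights_real that by blast
  note ws = integral_weights_weyl_act[OF \<sigma> int]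
  have "order (- ?s) ?p = (\<Sum>\<nu>\<in>weights \<phi>. if \<nu> = weyl_act \<sigma> \<mu> then weight_mult \<phi> \<nu> else 0)"
    unfolding order_prod_linear_powers[OF finite_weights]
    by (intro sum.cong refl) (simp add: eq int ws[OF \<mu>])
  \<comment> \<open>If the image were not a weight, both sides would be 0. The equality of
    multiplicities therefore also shows, in \<open>weight_mult_orbit\<close>, that the image is a
    weight.\<close>
  also have "\<dots> = weight_mult \<phi> (weyl_act \<sigma> \<mu>)"
    using weight_mult_eq_0_iff[of \<phi> "weyl_act \<sigma> \<mu>"] finite_weights[of \<phi>] by simp
  finally have "weight_mult \<phi> (weyl_act \<sigma> \<mu>) = order (- ?s) ?q" using \<open>?p = ?q\<close> by simp
  also have "\<dots> = (\<Sum>\<nu>\<in>weights \<phi>. if \<nu> = \<mu> then weight_mult \<phi> \<nu> else 0)"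
    unfolding order_prod_linear_powers[OF finite_weights]
    using weyl_act_inj[OF \<sigma>, of _ \<mu>] by (intro sum.cong refl) (auto simp: eq ws \<mu>)
  also have "\<dots> = weight_mult \<phi> \<mu>" using \<mu> finite_weights[of \<phi>] by simp
  finally show ?thesis .
qed

lemma weight_mult_orbit:
  assumes "is_irreducible_rep \<phi>" "has_highest_weight \<phi> hw" "\<mu> \<in> weights \<phi>" "\<nu> \<in> orbit \<mu>"
  shows "weight_mult \<phi> \<nu> = weight_mult \<phi> \<mu>" "\<nu> \<in> weights \<phi>"
proof -
  obtain \<sigma> where "\<sigma> permutes UNIV" "\<nu> = weyl_act \<sigma> \<mu>" using assms(4) unfolding orbit_def by blast
  then show "weight_mult \<phi> \<nu> = weight_mult \<phi> \<mu>" using weight_mult_weyl_act assms(1-3) by blast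
  then show "\<nu> \<in> weights \<phi>" using weight_mult_eq_0_iff[of \<phi>] assms(3) by metis
qed

section \<open>The characteristic polynomial and its factorisation\<close>

lemma char_poly_eval:
  assumes rep: "is_rep \<phi>"
  shows "mpoly_eval (char_poly \<phi>) c = det (mat (c 0) + \<phi> (sl3_elem c))"
proof -
  have "polymat (\<lambda>c. \<phi> (sl3_elem c))"
    unfolding polymat_def rep_sl3_elem[OF rep] by (intro allI polyfun_sum polyfun_mult polyfun_var polyfun_const)
  then have "polyfun (\<lambda>c. det (mat (c 0) + \<phi> (sl3_elem c)))"
    by (intro polyfun_det_polymat polymat_intros polyfun_var)
  then obtain p where p: "\<forall>c. mpoly_eval p c = det (mat (c 0) + \<phi> (sl3_elem c))"
    unfolding polyfun_def by blast
  have "\<forall>c. mpoly_eval (char_poly \<phi>) c = det (mat (c 0) + \<phi> (sl3_elem c))"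
    unfolding char_poly_def
    by (rule theI[of "\<lambda>p. \<forall>c. mpoly_eval p c = det (mat (c 0) + \<phi> (sl3_elem c))", OF p])
       (rule mpoly_eqI, simp add: p)
  then show ?thesis by blast
qed

theorem theorem3p4:
  fixes \<phi> :: "complex^3^3 \<Rightarrow> complex^'n^'n" and hw :: weight
  assumes "is_irreducible_rep \<phi>"
    and "has_highest_weight \<phi> hw"
  shows "finite {\<mu>\<in>weights \<phi>. dominant \<mu>}
    \<and> char_poly \<phi> = (\<Prod>\<mu>\<in>{\<mu>\<in>weights \<phi>. dominant \<mu>}. orbital_factor \<mu> ^ weight_mult \<phi> \<mu>)
    \<and> (\<forall>\<mu>\<in>{\<mu>\<in>weights \<phi>. dominant \<mu>}.
         irreducible (orbital_factor \<mu>) \<and> total_degree (orbital_factor \<mu>) = card (orbit \<mu>))"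
proof (intro conjI ballI)
  let ?D = "{\<mu>\<in>weights \<phi>. dominant \<mu>}"
  have rep: "is_rep \<phi>" using assms(1) unfolding is_irreducible_rep_def by blast
  show finD: "finite ?D" using finite_weights[of \<phi>] by simp
  \<comment> \<open>The dominant weights represent the Weyl orbits in the set of weights:
    \<open>W\<close> says that every orbit has a dominant point, \<open>disj\<close> that it has
    only one. The product over weights can then be regrouped by orbits.\<close>
  have W: "weights \<phi> = (\<Union>\<mu>\<in>?D. orbit \<mu>)"
  proof
    show "(\<Union>\<mu>\<in>?D. orbit \<mu>) \<subseteq> weights \<phi>" using weight_mult_orbit(2)[OF assms] by blast
    show "weights \<phi> \<subseteq> (\<Union>\<mu>\<in>?D. orbit \<mu>)"
    proof
      fix \<nu> assume \<nu>: "\<nu> \<in> weights \<phi>"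
      then have "\<nu> \<in> integral_weights" using weight_basis_exists(1)[OF assms] by blast
      then obtain \<mu> where \<mu>: "\<mu> \<in> orbit \<nu>" "dominant \<mu>"
        using integral_orbit_dominant[of \<nu>] unfolding integral_weights_def by blast
      have "\<mu> \<in> ?D" using weight_mult_orbit(2)[OF assms \<nu> \<mu>(1)] \<mu>(2) by simp
      moreover have "\<nu> \<in> orbit \<mu>" using orbit_eqI[OF \<mu>(1)] mem_orbit_self[of \<nu>] by simp
      ultimately show "\<nu> \<in> (\<Union>\<mu>\<in>?D. orbit \<mu>)" by blast
    qed
  qed
  have disj: "\<forall>\<mu>\<in>?D. \<forall>\<nu>\<in>?D. \<mu> \<noteq> \<nu> \<longrightarrow> orbit \<mu> \<inter> orbit \<nu> = {}"
  proof (intro ballI impI equals0I)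
    fix \<mu> \<nu> \<kappa> assume *: "\<mu> \<in> ?D" "\<nu> \<in> ?D" "\<mu> \<noteq> \<nu>" "\<kappa> \<in> orbit \<mu> \<inter> orbit \<nu>"
    then have "orbit \<mu> = orbit \<nu>" using orbit_eqI[of \<kappa> \<mu>] orbit_eqI[of \<kappa> \<nu>] by simp
    then have "\<nu> \<in> orbit \<mu>" by simp
    then show False using dominant_mem_orbit_unique[of \<mu> \<nu>] * by simp
  qed
  show "char_poly \<phi> = (\<Prod>\<mu>\<in>?D. orbital_factor \<mu> ^ weight_mult \<phi> \<mu>)"
  proof (rule mpoly_eqI_diagonalizable)
    fix c P \<theta> assume c: "invertible P" "sl3_elem c = P ** diag_mat \<theta> ** matrix_inv P"
    have sum: "\<theta>$1 + \<theta>$2 + \<theta>$3 = 0" by (rule diag_theta_sum[OF c])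
    have "mpoly_eval (char_poly \<phi>) c = (\<Prod>\<nu>\<in>weights \<phi>. (c 0 + wt_at \<nu> \<theta>) ^ weight_mult \<phi> \<nu>)"
      by (simp add: char_poly_eval[OF rep] c(2) rep_det_conj[OF rep c(1) diag_mat_in_sl3[OF sum]]
          det_rep_diag[OF assms sum])
    also have "\<dots> = (\<Prod>\<mu>\<in>?D. \<Prod>\<nu>\<in>orbit \<mu>. (c 0 + wt_at \<nu> \<theta>) ^ weight_mult \<phi> \<nu>)"
      by (subst (1) W) (intro prod.UNION_disjoint finD disj, simp)
    also have "\<dots> = (\<Prod>\<mu>\<in>?D. (\<Prod>\<nu>\<in>orbit \<mu>. c 0 + wt_at \<nu> \<theta>) ^ weight_mult \<phi> \<mu>)"
      unfolding prod_power_distrib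
      using weight_mult_orbit(1)[OF assms] by (intro prod.cong refl) (metis (lifting) mem_Collect_eq)
    also have "\<dots> = mpoly_eval (\<Prod>\<mu>\<in>?D. orbital_factor \<mu> ^ weight_mult \<phi> \<mu>) c"
      by (simp add: mpoly_eval_prod mpoly_eval_power orbital_factor_eval[OF _ c])
    finally show "mpoly_eval (char_poly \<phi>) c = mpoly_eval (\<Prod>\<mu>\<in>?D. orbital_factor \<mu> ^ weight_mult \<phi> \<mu>) c" .
  qed
  show "irreducible (orbital_factor \<mu>)" "total_degree (orbital_factor \<mu>) = card (orbit \<mu>)" if "\<mu> \<in> ?D" for \<mu>
    using that irreducible_orbital_factor total_degree_orbital_factor by auto
qed

end
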